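(* Let $n\ge 2$ and let $M$ be a (nonempty) smooth manifold of dimension $2n+1\ge 5$. Then $M$ admits no paracontact metric structure $(\varphi,\xi,\eta,g)$ of vanishing curvature; that is, there is no paracontact metric structure $(\varphi,\xi,\eta,g)$ on $M$ such that the Riemann curvature tensor $R$ of the Levi-Civita connection of $g$ vanishes identically.
   Context: An almost paracontact structure $(\varphi,\xi,\eta)$ on a smooth manifold $M$ of dimension $2n+1$ consists of a $(1,1)$-tensor field $\varphi$, a vector field $\xi$ and a $1$-form $\eta$ such that: (i) $\varphi(\xi)=0$ and $\eta\circ\varphi=0$; (ii) $\eta(\xi)=1$ and $\varphi^2=\mathrm{id}-\eta\otimes\xi$; (iii) $\varphi$ induces an almost paracomplex structure on each fibre of the horizontal distribution $\mathbb D=\ker\eta$, i.e. $\varphi|_{\mathbb D}$ squares to the identity and its $+1$ and $-1$ eigenspaces in each fibre both have dimension $n$. An almost paracontact metric structure $(\varphi,\xi,\eta,g)$ is an almost paracontact structure together with a pseudo-Riemannian metric $g$ satisfying $g(\varphi X,\varphi Y)=-g(X,Y)+\eta(X)\eta(Y)$ for all vector fields $X,Y$ (such a $g$ necessarily has signature $(n+1,n)$, and $\eta(X)=g(X,\xi)$). A paracontact metric structure is an almost paracontact metric structure such that $g(X,\varphi Y)=d\eta(X,Y)$ for all vector fields $X,Y$, with the convention $d\eta(X,Y)=\frac12\big(X\eta(Y)-Y\eta(X)-\eta([X,Y])\big)$. *)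

theory Defs
  imports "HOL-Analysis.Analysis" "HOL-Library.Function_Algebras"
begin

text \<open>
  Tangent vectors are represented below by real-valued operators on functions, so the pointwise real
  vector space structure on function types is needed for \<^const>\<open>subspace\<close>, \<^const>\<open>dim\<close> etc.
\<close>

instantiation "fun" :: (type, real_vector) real_vector
begin

definition scaleR_fun :: "real \<Rightarrow> ('a \<Rightarrow> 'b) \<Rightarrow> 'a \<Rightarrow> 'b" where
  "scaleR_fun c f = (\<lambda>x. c *\<^sub>R f x)"

instance
  by standard (auto simp: scaleR_fun_def fun_eq_iff algebra_simps)

end

definition linear_on_subspace :: "'a::real_vector set \<Rightarrow> ('a \<Rightarrow> 'b::real_vector) \<Rightarrow> bool" where
  "linear_on_subspace S f \<longleftrightarrow>
     (\<forall>x\<in>S. \<forall>y\<in>S. f (x + y) = f x + f y) \<and> (\<forall>c. \<forall>x\<in>S. f (c *\<^sub>R x) = c *\<^sub>R f x)"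


section \<open>Smooth manifolds\<close>

text \<open>
  \<open>C_k k S f\<close> is meant for open \<open>S\<close>: all iterated directional derivatives of \<open>f\<close> up to order \<open>k\<close>
  exist and are continuous on \<open>S\<close>.
\<close>

primrec C_k :: "nat \<Rightarrow> 'e::euclidean_space set \<Rightarrow> ('e \<Rightarrow> 'b::real_normed_vector) \<Rightarrow> bool" where
  "C_k 0 S f \<longleftrightarrow> continuous_on S f"
| "C_k (Suc k) S f \<longleftrightarrow>
     (\<forall>x\<in>S. f differentiable at x) \<and> (\<forall>v. C_k k S (\<lambda>x. frechet_derivative f (at x) v))"

definition smooth_on :: "'e::euclidean_space set \<Rightarrow> ('e \<Rightarrow> 'b::real_normed_vector) \<Rightarrow> bool" where
  "smooth_on S f \<longleftrightarrow> (\<forall>k. C_k k S f)"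

text \<open>A chart is a domain together with a coordinate map, which is relevant only on the domain.\<close>

type_synonym ('a, 'e) chart = "'a set \<times> ('a \<Rightarrow> 'e)"

abbreviation chart_inv :: "('a, 'e) chart \<Rightarrow> 'e \<Rightarrow> 'a" where
  "chart_inv c \<equiv> inv_into (fst c) (snd c)"

text \<open>
  The manifold is the whole type \<open>'a\<close>; it is nonempty because types are. The sort constraint
  makes it Hausdorff and second countable, and its dimension is \<open>DIM('e)\<close>. The atlas need not be
  maximal.
\<close>

definition smooth_atlas ::
  "('a::{t2_space, second_countable_topology}, 'e::euclidean_space) chart set \<Rightarrow> bool" where
  "smooth_atlas A \<longleftrightarrow>
     (\<Union>c\<in>A. fst c) = UNIV \<and>
     (\<forall>c\<in>A. open (fst c) \<and> open (snd c ` fst c) \<and>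
        homeomorphism (fst c) (snd c ` fst c) (snd c) (chart_inv c)) \<and>
     (\<forall>c\<in>A. \<forall>d\<in>A. smooth_on (snd c ` (fst c \<inter> fst d)) (snd d \<circ> chart_inv c))"

definition smooth_functions :: "('a, 'e::euclidean_space) chart set \<Rightarrow> ('a \<Rightarrow> real) set" where
  "smooth_functions A = {f. \<forall>c\<in>A. smooth_on (snd c ` fst c) (f \<circ> chart_inv c)}"


section \<open>Tangent vectors and tensor fields\<close>

type_synonym 'a tangent_vector = "('a \<Rightarrow> real) \<Rightarrow> real"
type_synonym 'a field = "'a \<Rightarrow> 'a tangent_vector"

text \<open>
  The derivation \<open>\<Sum>i. w\<^sub>i \<partial>/\<partial>x\<^sub>i\<close> at \<open>p\<close> on smooth functions, where \<open>x\<^sub>i\<close> are the coordinates of the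
  chart \<open>c\<close>. Its value on functions that are not smooth is fixed to 0, so that tangent vectors are
  equal as soon as they agree on smooth functions.
\<close>

definition coord_vector ::
  "('a, 'e::euclidean_space) chart set \<Rightarrow> ('a, 'e) chart \<Rightarrow> 'a \<Rightarrow> 'e \<Rightarrow> 'a tangent_vector" where
  "coord_vector A c p w = (\<lambda>f. if f \<in> smooth_functions A
      then frechet_derivative (f \<circ> chart_inv c) (at (snd c p)) w else 0)"

text \<open>By the chain rule, each single chart around \<open>p\<close> already yields all of the tangent space.\<close>

definition tangent_space ::
  "('a, 'e::euclidean_space) chart set \<Rightarrow> 'a \<Rightarrow> 'a tangent_vector set" where
  "tangent_space A p = {coord_vector A c p w | c w. c \<in> A \<and> p \<in> fst c}"

definition vector_fields :: "('a, 'e::euclidean_space) chart set \<Rightarrow> 'a field set" where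
  "vector_fields A = {X. (\<forall>p. X p \<in> tangent_space A p) \<and>
      (\<forall>f\<in>smooth_functions A. (\<lambda>p. X p f) \<in> smooth_functions A)}"

definition lie_bracket :: "'a field \<Rightarrow> 'a field \<Rightarrow> 'a field" where
  "lie_bracket X Y = (\<lambda>p f. X p (\<lambda>q. Y q f) - Y p (\<lambda>q. X q f))"

definition one_form ::
  "('a, 'e::euclidean_space) chart set \<Rightarrow> ('a \<Rightarrow> 'a tangent_vector \<Rightarrow> real) \<Rightarrow> bool" where
  "one_form A \<eta> \<longleftrightarrow>
     (\<forall>p. linear_on_subspace (tangent_space A p) (\<eta> p)) \<and>
     (\<forall>X\<in>vector_fields A. (\<lambda>p. \<eta> p (X p)) \<in> smooth_functions A)"

definition tensor_field_1_1 ::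
  "('a, 'e::euclidean_space) chart set \<Rightarrow>
   ('a \<Rightarrow> 'a tangent_vector \<Rightarrow> 'a tangent_vector) \<Rightarrow> bool" where
  "tensor_field_1_1 A \<phi> \<longleftrightarrow>
     (\<forall>p. \<forall>v\<in>tangent_space A p. \<phi> p v \<in> tangent_space A p) \<and>
     (\<forall>p. linear_on_subspace (tangent_space A p) (\<phi> p)) \<and>
     (\<forall>X\<in>vector_fields A. (\<lambda>p. \<phi> p (X p)) \<in> vector_fields A)"

definition pseudo_riemannian_metric ::
  "('a, 'e::euclidean_space) chart set \<Rightarrow>
   ('a \<Rightarrow> 'a tangent_vector \<Rightarrow> 'a tangent_vector \<Rightarrow> real) \<Rightarrow> bool" where
  "pseudo_riemannian_metric A g \<longleftrightarrow>
     (\<forall>p. \<forall>u\<in>tangent_space A p. linear_on_subspace (tangent_space A p) (g p u)) \<and>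
     (\<forall>p. \<forall>u\<in>tangent_space A p. \<forall>v\<in>tangent_space A p. g p u v = g p v u) \<and>
     (\<forall>p. \<forall>u\<in>tangent_space A p. (\<forall>v\<in>tangent_space A p. g p u v = 0) \<longrightarrow> u = 0) \<and>
     (\<forall>X\<in>vector_fields A. \<forall>Y\<in>vector_fields A. (\<lambda>p. g p (X p) (Y p)) \<in> smooth_functions A)"

text \<open>The normalization of the exterior derivative includes the factor \<open>1/2\<close>.\<close>

definition ext_deriv ::
  "('a \<Rightarrow> 'a tangent_vector \<Rightarrow> real) \<Rightarrow> 'a field \<Rightarrow> 'a field \<Rightarrow> 'a \<Rightarrow> real" where
  "ext_deriv \<eta> X Y p =
     (X p (\<lambda>q. \<eta> q (Y q)) - Y p (\<lambda>q. \<eta> q (X q)) - \<eta> p (lie_bracket X Y p)) / 2"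


section \<open>Levi-Civita connection and curvature\<close>

text \<open>Connections are constrained only on smooth vector fields.\<close>

definition affine_connection ::
  "('a, 'e::euclidean_space) chart set \<Rightarrow> ('a field \<Rightarrow> 'a field \<Rightarrow> 'a field) \<Rightarrow> bool" where
  "affine_connection A D \<longleftrightarrow>
     (\<forall>X\<in>vector_fields A. \<forall>Y\<in>vector_fields A. D X Y \<in> vector_fields A) \<and>
     (\<forall>X\<in>vector_fields A. \<forall>Y\<in>vector_fields A. \<forall>Z\<in>vector_fields A.
        D (X + Y) Z = D X Z + D Y Z \<and> D X (Y + Z) = D X Y + D X Z) \<and>
     (\<forall>f\<in>smooth_functions A. \<forall>X\<in>vector_fields A. \<forall>Y\<in>vector_fields A.
        D (\<lambda>p. f p *\<^sub>R X p) Y = (\<lambda>p. f p *\<^sub>R D X Y p) \<and>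
        D X (\<lambda>p. f p *\<^sub>R Y p) = (\<lambda>p. X p f *\<^sub>R Y p + f p *\<^sub>R D X Y p))"

definition levi_civita_connection ::
  "('a, 'e::euclidean_space) chart set \<Rightarrow>
   ('a \<Rightarrow> 'a tangent_vector \<Rightarrow> 'a tangent_vector \<Rightarrow> real) \<Rightarrow>
   ('a field \<Rightarrow> 'a field \<Rightarrow> 'a field) \<Rightarrow> bool" where
  "levi_civita_connection A g D \<longleftrightarrow>
     affine_connection A D \<and>
     (\<forall>X\<in>vector_fields A. \<forall>Y\<in>vector_fields A. D X Y - D Y X = lie_bracket X Y) \<and>
     (\<forall>X\<in>vector_fields A. \<forall>Y\<in>vector_fields A. \<forall>Z\<in>vector_fields A. \<forall>p.
        X p (\<lambda>q. g q (Y q) (Z q)) = g p (D X Y p) (Z p) + g p (Y p) (D X Z p))"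

definition curvature ::
  "('a field \<Rightarrow> 'a field \<Rightarrow> 'a field) \<Rightarrow> 'a field \<Rightarrow> 'a field \<Rightarrow> 'a field \<Rightarrow> 'a field" where
  "curvature D X Y Z = D X (D Y Z) - D Y (D X Z) - D (lie_bracket X Y) Z"


section \<open>Paracontact metric structures\<close>

definition almost_paracontact_structure ::
  "('a, 'e::euclidean_space) chart set \<Rightarrow> nat \<Rightarrow>
   ('a \<Rightarrow> 'a tangent_vector \<Rightarrow> 'a tangent_vector) \<Rightarrow> 'a field \<Rightarrow>
   ('a \<Rightarrow> 'a tangent_vector \<Rightarrow> real) \<Rightarrow> bool" where
  "almost_paracontact_structure A n \<phi> \<xi> \<eta> \<longleftrightarrow>
     DIM('e) = 2 * n + 1 \<and>
     tensor_field_1_1 A \<phi> \<and> \<xi> \<in> vector_fields A \<and> one_form A \<eta> \<and>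
     (\<forall>p. \<phi> p (\<xi> p) = 0) \<and> (\<forall>p. \<forall>v\<in>tangent_space A p. \<eta> p (\<phi> p v) = 0) \<and>
     (\<forall>p. \<eta> p (\<xi> p) = 1) \<and>
     (\<forall>p. \<forall>v\<in>tangent_space A p. \<phi> p (\<phi> p v) = v - \<eta> p v *\<^sub>R \<xi> p) \<and>
     (\<forall>p. let H = {v \<in> tangent_space A p. \<eta> p v = 0} in
        (\<forall>v\<in>H. \<phi> p v \<in> H \<and> \<phi> p (\<phi> p v) = v) \<and>
        dim {v \<in> H. \<phi> p v = v} = n \<and> dim {v \<in> H. \<phi> p v = - v} = n)"

definition almost_paracontact_metric_structure ::
  "('a, 'e::euclidean_space) chart set \<Rightarrow> nat \<Rightarrow>
   ('a \<Rightarrow> 'a tangent_vector \<Rightarrow> 'a tangent_vector) \<Rightarrow> 'a field \<Rightarrow>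
   ('a \<Rightarrow> 'a tangent_vector \<Rightarrow> real) \<Rightarrow>
   ('a \<Rightarrow> 'a tangent_vector \<Rightarrow> 'a tangent_vector \<Rightarrow> real) \<Rightarrow> bool" where
  "almost_paracontact_metric_structure A n \<phi> \<xi> \<eta> g \<longleftrightarrow>
     almost_paracontact_structure A n \<phi> \<xi> \<eta> \<and> pseudo_riemannian_metric A g \<and>
     (\<forall>X\<in>vector_fields A. \<forall>Y\<in>vector_fields A. \<forall>p.
        g p (\<phi> p (X p)) (\<phi> p (Y p)) = - g p (X p) (Y p) + \<eta> p (X p) * \<eta> p (Y p))"

definition paracontact_metric_structure ::
  "('a, 'e::euclidean_space) chart set \<Rightarrow> nat \<Rightarrow>
   ('a \<Rightarrow> 'a tangent_vector \<Rightarrow> 'a tangent_vector) \<Rightarrow> 'a field \<Rightarrow>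
   ('a \<Rightarrow> 'a tangent_vector \<Rightarrow> real) \<Rightarrow>
   ('a \<Rightarrow> 'a tangent_vector \<Rightarrow> 'a tangent_vector \<Rightarrow> real) \<Rightarrow> bool" where
  "paracontact_metric_structure A n \<phi> \<xi> \<eta> g \<longleftrightarrow>
     almost_paracontact_metric_structure A n \<phi> \<xi> \<eta> g \<and>
     (\<forall>X\<in>vector_fields A. \<forall>Y\<in>vector_fields A. \<forall>p.
        g p (X p) (\<phi> p (Y p)) = ext_deriv \<eta> X Y p)"

end

theory Submission
  imports Defs
begin

text \<open>
  Let \<open>a = \<nabla>\<xi>\<close> and let \<open>b\<close> be its adjoint with respect to the metric. The paracontact condition says that
  \<open>b = a + 2 \<phi>\<close>. In a flat manifold the Codazzi equation holds: \<open>(\<nabla>\<^sub>X a) Y\<close> is symmetric in \<open>X\<close> and \<open>Y\<close>. Since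
  \<open>a \<xi> = 0\<close>, this gives \<open>\<nabla>\<^sub>\<xi> a = -a\<^sup>2\<close>. Differentiating \<open>\<phi>\<^sup>2 = id - \<eta> \<otimes> \<xi>\<close> along \<open>\<xi>\<close> twice then shows that
  the symmetric part of \<open>a\<close> anticommutes with \<open>\<phi>\<close> and that \<open>a\<^sup>2 = b\<^sup>2 = 0\<close> (lemmas \<open>s_\<Phi>\<close>, \<open>a_a\<close>, \<open>b_b\<close>). Hence
  \<open>ab + ba = -4 \<phi>\<^sup>2\<close>, so that the horizontal distribution splits into the images of \<open>a\<close> and \<open>b\<close>.

  Differentiating this relation in all directions and combining it with the Codazzi equation produces
  trilinear expressions that are symmetric in one pair of arguments and skew in another, hence zero.
  What remains is \<open>(\<nabla>\<^sub>X a) Y = -g(aX, aY) \<xi>\<close> (lemma \<open>Da_eq\<close>). Now the second derivatives of \<open>a\<close> are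
  symmetric as well, again by flatness, and up to multiples of \<open>\<xi>\<close> this reads
  \<open>g(aY, aZ) aX = g(aX, aZ) aY\<close>: the form \<open>g(a\<cdot>, a\<cdot>)\<close> has rank at most one (lemma
  \<open>G_a_a_rank_one\<close>). Between the \<open>+1\<close>- and \<open>-1\<close>-eigenspaces of \<open>\<phi>\<close> this form is \<open>-2 g\<close>, and there \<open>g\<close> is a
  nondegenerate pairing. So the eigenspaces have dimension at most one, which contradicts \<open>n \<ge> 2\<close>.

  All of this takes place in the module of global vector fields, using only the algebraic rules for a
  metric connection. Manifold theory is needed to know that this module is rich enough: every tangent
  vector extends to a smooth vector field (lemma \<open>vector_field_through\<close>), by a bump function.
\<close>

section \<open>Calculus of iterated directional derivatives\<close>

lemma C_k_cong:
  fixes f g :: "'e::euclidean_space \<Rightarrow> 'b::real_normed_vector"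
  assumes "open S" "\<And>x. x \<in> S \<Longrightarrow> f x = g x" "C_k k S f"
  shows "C_k k S g"
  using assms(2,3)
proof (induction k arbitrary: f g)
  case 0
  then show ?case by (simp cong: continuous_on_cong)
next
  case (Suc k)
  have der: "(g has_derivative frechet_derivative f (at x)) (at x)" if "x \<in> S" for x
  proof -
    have "(f has_derivative frechet_derivative f (at x)) (at x)"
      using Suc.prems that by (simp add: frechet_derivative_works)
    then show ?thesis
      by (rule has_derivative_transform_within_open[OF _ assms(1) that]) (use Suc.prems in auto)
  qed
  have eq: "frechet_derivative f (at x) = frechet_derivative g (at x)" if "x \<in> S" for x
    using der[OF that] by (rule frechet_derivative_at)
  have "C_k k S (\<lambda>x. frechet_derivative g (at x) v)" for v
    by (rule Suc.IH[of "\<lambda>x. frechet_derivative f (at x) v"]) (use Suc.prems eq in auto)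
  then show ?case
    using der by (auto simp: differentiable_def)
qed

text \<open>
  The closure rules below compute derivatives \<open>f'\<close> by hand, whereas \<open>C_k\<close> speaks of the chosen
  \<^const>\<open>frechet_derivative\<close>, which agrees with \<open>f'\<close> only on \<open>S\<close>. This rule hides the passage.
\<close>

lemma C_k_SucI:
  assumes "open S" "\<And>x. x \<in> S \<Longrightarrow> (f has_derivative f' x) (at x)" "\<And>v. C_k k S (\<lambda>x. f' x v)"
  shows "C_k (Suc k) S f"
proof -
  have "C_k k S (\<lambda>x. frechet_derivative f (at x) v)" for v
  proof (rule C_k_cong[OF assms(1) _ assms(3)])
    show "f' x v = frechet_derivative f (at x) v" if "x \<in> S" for x
      using frechet_derivative_at[OF assms(2)[OF that]] by simp
  qed
  then show ?thesis
    using assms(2) by (auto simp: differentiable_def)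
qed

lemma C_k_Suc_has_derivative:
  assumes "C_k (Suc k) S f" "x \<in> S"
  shows "(f has_derivative frechet_derivative f (at x)) (at x)"
  using assms by (simp add: frechet_derivative_works)

lemma C_k_SucD: "C_k (Suc k) S f \<Longrightarrow> C_k k S f"
proof (induction k arbitrary: f)
  case 0
  then show ?case
    by (auto intro!: continuous_at_imp_continuous_on differentiable_imp_continuous_within)
qed auto

lemma C_k_subset: "C_k k S f \<Longrightarrow> T \<subseteq> S \<Longrightarrow> C_k k T f"
  by (induction k arbitrary: f) (auto intro: continuous_on_subset)

lemma C_k_local:
  assumes "\<And>x. x \<in> S \<Longrightarrow> \<exists>U. open U \<and> x \<in> U \<and> C_k k U f"
  shows "C_k k S f"
  using assms
proof (induction k arbitrary: f)
  case 0
  show ?case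
  proof (rule continuous_at_imp_continuous_on[THEN C_k.simps(1)[THEN iffD2]], rule ballI)
    show "isCont f x" if "x \<in> S" for x
      using 0[OF that] by (auto simp: continuous_on_eq_continuous_at)
  qed
next
  case (Suc k)
  have "f differentiable at x" if "x \<in> S" for x
    using Suc.prems[OF that] by auto
  moreover have "C_k k S (\<lambda>x. frechet_derivative f (at x) v)" for v
    by (rule Suc.IH) (use Suc.prems in fastforce)
  ultimately show ?case by simp
qed

lemma C_k_const: "C_k k S (\<lambda>_. c)"
  by (induction k arbitrary: c) auto

lemma C_k_add:
  assumes "open S"
  shows "C_k k S f \<Longrightarrow> C_k k S g \<Longrightarrow> C_k k S (\<lambda>x. f x + g x)"
proof (induction k arbitrary: f g)
  case (Suc k)
  show ?case
  proof (rule C_k_SucI[OF assms])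
    show "((\<lambda>x. f x + g x) has_derivative
       (\<lambda>v. frechet_derivative f (at x) v + frechet_derivative g (at x) v)) (at x)" if "x \<in> S" for x
      by (intro has_derivative_add C_k_Suc_has_derivative[OF Suc.prems(1) that]
          C_k_Suc_has_derivative[OF Suc.prems(2) that])
    show "C_k k S (\<lambda>x. frechet_derivative f (at x) v + frechet_derivative g (at x) v)" for v
      by (rule Suc.IH) (use Suc.prems in auto)
  qed
qed (auto intro: continuous_on_add)

lemma C_k_sum:
  assumes "open S" "finite I" "\<And>i. i \<in> I \<Longrightarrow> C_k k S (f i)"
  shows "C_k k S (\<lambda>x. \<Sum>i\<in>I. f i x)"
  using assms(2,3) by (induction I) (auto intro: C_k_add[OF assms(1)] C_k_const)

lemma C_k_mult:
  fixes f g :: "'e::euclidean_space \<Rightarrow> real"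
  assumes "open S"
  shows "C_k k S f \<Longrightarrow> C_k k S g \<Longrightarrow> C_k k S (\<lambda>x. f x * g x)"
proof (induction k arbitrary: f g)
  case (Suc k)
  show ?case
  proof (rule C_k_SucI[OF assms])
    show "((\<lambda>x. f x * g x) has_derivative
       (\<lambda>v. f x * frechet_derivative g (at x) v + frechet_derivative f (at x) v * g x)) (at x)"
      if "x \<in> S" for x
      by (intro has_derivative_mult C_k_Suc_has_derivative[OF Suc.prems(1) that]
          C_k_Suc_has_derivative[OF Suc.prems(2) that])
    show "C_k k S (\<lambda>x. f x * frechet_derivative g (at x) v + frechet_derivative f (at x) v * g x)"
      for v
      using Suc.prems Suc.prems[THEN C_k_SucD] by (intro C_k_add[OF assms] Suc.IH) auto
  qed
qed (auto intro: continuous_on_mult)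

lemma C_k_bounded_linear_compose:
  assumes "open S" "bounded_linear L"
  shows "C_k k S f \<Longrightarrow> C_k k S (\<lambda>x. L (f x))"
proof (induction k arbitrary: f)
  case 0
  then show ?case
    using bounded_linear.continuous_on[OF assms(2)] by simp
next
  case (Suc k)
  show ?case
  proof (rule C_k_SucI[OF assms(1)])
    show "((\<lambda>x. L (f x)) has_derivative (\<lambda>v. L (frechet_derivative f (at x) v))) (at x)"
      if "x \<in> S" for x
      by (rule bounded_linear.has_derivative[OF assms(2)])
        (rule C_k_Suc_has_derivative[OF Suc.prems that])
    show "C_k k S (\<lambda>x. L (frechet_derivative f (at x) v))" for v
      by (rule Suc.IH) (use Suc.prems in auto)
  qed
qed

lemma C_k_id:
  assumes "open S"
  shows "C_k k S (\<lambda>x. x)"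
proof (cases k)
  case (Suc j)
  show ?thesis
    unfolding Suc by (rule C_k_SucI[OF assms]) (auto intro: has_derivative_ident C_k_const)
qed auto

text \<open>
  The chain rule expresses each directional derivative of \<open>h \<circ> \<tau>\<close> as a finite sum of products of
  components of \<open>\<tau>'\<close> with partial derivatives of \<open>h\<close> composed with \<open>\<tau>\<close>. The latter are covered by
  the induction hypothesis, so closure under products and sums finishes the step.
\<close>

lemma C_k_compose:
  fixes \<tau> :: "'e::euclidean_space \<Rightarrow> 'f::euclidean_space" and h :: "'f \<Rightarrow> real"
  assumes "open S" "\<tau> ` S \<subseteq> T"
  shows "C_k k S \<tau> \<Longrightarrow> C_k k T h \<Longrightarrow> C_k k S (\<lambda>x. h (\<tau> x))"
proof (induction k arbitrary: h)
  case 0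
  then show ?case
    using continuous_on_compose2[OF _ _ assms(2)] by auto
next
  case (Suc k)
  define h' where "h' = (\<lambda>y. frechet_derivative h (at y))"
  define \<tau>' where "\<tau>' = (\<lambda>x. frechet_derivative \<tau> (at x))"
  have h': "(h has_derivative h' (\<tau> x)) (at (\<tau> x))" if "x \<in> S" for x
    unfolding h'_def by (rule C_k_Suc_has_derivative[OF Suc.prems(2)]) (use assms(2) that in auto)
  show ?case
  proof (rule C_k_SucI[OF assms(1)])
    show "((\<lambda>x. h (\<tau> x)) has_derivative
      (\<lambda>v. \<Sum>b\<in>Basis. (\<tau>' x v \<bullet> b) * h' (\<tau> x) b)) (at x)" if "x \<in> S" for x
    proof -
      have "((\<lambda>x. h (\<tau> x)) has_derivative (\<lambda>v. h' (\<tau> x) (\<tau>' x v))) (at x)"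
        unfolding \<tau>'_def
        by (rule has_derivative_compose[OF C_k_Suc_has_derivative[OF Suc.prems(1) that] h'[OF that]])
      moreover have "h' (\<tau> x) (\<tau>' x v) = (\<Sum>b\<in>Basis. (\<tau>' x v \<bullet> b) * h' (\<tau> x) b)" for v
      proof -
        interpret linear "h' (\<tau> x)"
          using h'[OF that] by (rule has_derivative_linear)
        have "h' (\<tau> x) (\<tau>' x v) = h' (\<tau> x) (\<Sum>b\<in>Basis. (\<tau>' x v \<bullet> b) *\<^sub>R b)"
          by (simp add: euclidean_representation)
        then show ?thesis by (simp add: sum scale)
      qed
      ultimately show ?thesis by simp
    qed
    show "C_k k S (\<lambda>x. \<Sum>b\<in>Basis. (\<tau>' x v \<bullet> b) * h' (\<tau> x) b)" for v
    proof (intro C_k_sum C_k_mult assms(1) finite_Basis)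
      fix b :: 'f
      show "C_k k S (\<lambda>x. \<tau>' x v \<bullet> b)"
        by (rule C_k_bounded_linear_compose[OF assms(1) bounded_linear_inner_left])
          (use Suc.prems in \<open>auto simp: \<tau>'_def\<close>)
      show "C_k k S (\<lambda>x. h' (\<tau> x) b)"
        by (rule Suc.IH) (use Suc.prems C_k_SucD[OF Suc.prems(1)] in \<open>auto simp: h'_def\<close>)
    qed
  qed
qed

section \<open>Bump functions\<close>

text \<open>
  The function \<open>exp (-1/t)\<close>, extended by 0 to \<open>t \<le> 0\<close>, is the case \<open>n = 0\<close>. The extra factor
  \<open>t\<^sup>-\<^sup>n\<close> makes the family closed under differentiation up to linear combinations, so that smoothness
  of all members is one induction.
\<close>

definition flat_exp :: "nat \<Rightarrow> real \<Rightarrow> real" where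
  "flat_exp n t = (if t > 0 then exp (- inverse t) * inverse t ^ n else 0)"

lemma flat_exp_tendsto_0: "(flat_exp n \<longlongrightarrow> 0) (at 0)"
proof -
  have "((\<lambda>x::real. x ^ n / exp x) \<longlongrightarrow> 0) at_top"
    by (rule tendsto_power_div_exp_0)
  then have "((\<lambda>t::real. inverse t ^ n / exp (inverse t)) \<longlongrightarrow> 0) (at_right 0)"
    by (rule filterlim_compose) (rule filterlim_inverse_at_top_right)
  then have "(flat_exp n \<longlongrightarrow> 0) (at_right 0)"
    by (rule Lim_transform_eventually)
      (auto simp: eventually_at_filter flat_exp_def exp_minus field_simps)
  moreover have "(flat_exp n \<longlongrightarrow> 0) (at_left 0)"
    by (rule Lim_transform_eventually[OF tendsto_const])
      (auto simp: eventually_at_filter flat_exp_def)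
  ultimately show ?thesis
    by (simp add: filterlim_at_split)
qed

lemma flat_exp_has_derivative:
  "(flat_exp n has_real_derivative flat_exp (n + 2) t - n * flat_exp (n + 1) t) (at t)"
proof -
  consider "t > 0" | "t < 0" | "t = 0" by linarith
  then show ?thesis
  proof cases
    case 1
    have "((\<lambda>t. exp (- inverse t) * inverse t ^ n) has_real_derivative
       flat_exp (n + 2) t - n * flat_exp (n + 1) t) (at t)"
      using 1 by (auto intro!: derivative_eq_intros simp: flat_exp_def power2_eq_square algebra_simps)
         (cases n; simp add: field_simps)
    then show ?thesis
      by (rule has_field_derivative_transform_within_open[of _ _ _ "{0<..}"])
        (use 1 in \<open>auto simp: flat_exp_def\<close>)
  next
    case 2
    have "((\<lambda>t. 0) has_real_derivative flat_exp (n + 2) t - n * flat_exp (n + 1) t) (at t)"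
      using 2 by (simp add: flat_exp_def)
    then show ?thesis
      by (rule has_field_derivative_transform_within_open[of _ _ _ "{..<0}"])
        (use 2 in \<open>auto simp: flat_exp_def\<close>)
  next
    case 3
    have "((\<lambda>h. (flat_exp n (0 + h) - flat_exp n 0) / h) \<longlongrightarrow> 0) (at 0)"
      by (rule Lim_transform_eventually[OF flat_exp_tendsto_0[of "Suc n"]])
        (auto simp: eventually_at_filter flat_exp_def field_simps)
    then show ?thesis
      by (simp add: 3 DERIV_def flat_exp_def)
  qed
qed

lemma C_k_flat_exp: "C_k k UNIV (flat_exp n)"
proof (induction k arbitrary: n)
  case 0
  then show ?case
    using flat_exp_has_derivative
    by (auto intro!: continuous_at_imp_continuous_on DERIV_isCont)
next
  case (Suc k)
  show ?case
  proof (rule C_k_SucI)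
    show "(flat_exp n has_derivative
        (\<lambda>v. (flat_exp (n + 2) t + (- real n) * flat_exp (n + 1) t) * v)) (at t)" for t
      using flat_exp_has_derivative[of n t] by (simp add: has_field_derivative_def)
    show "C_k k UNIV (\<lambda>t. (flat_exp (n + 2) t + (- real n) * flat_exp (n + 1) t) * v)" for v
      by (intro C_k_mult C_k_add C_k_const Suc.IH open_UNIV)
  qed auto
qed

text \<open>
  The function is \<open>exp (-1/t)\<close>, extended by 0, evaluated at \<open>t = r\<^sup>2 - |x - z|\<^sup>2\<close> and normalised at
  the centre.
\<close>

lemma bump_function:
  fixes z :: "'e::euclidean_space"
  assumes "r > 0"
  obtains \<beta> :: "'e \<Rightarrow> real"
  where "smooth_on UNIV \<beta>" "\<beta> z = 1" "\<And>x. x \<notin> cball z r \<Longrightarrow> \<beta> x = 0"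
proof
  \<comment> \<open>Sums and products only, so that the closure rules for \<open>C_k\<close> apply syntactically.\<close>
  define \<rho> where "\<rho> = (\<lambda>x::'e. r\<^sup>2 + (- 1) * (\<Sum>b\<in>Basis. ((x + - z) \<bullet> b) * ((x + - z) \<bullet> b)))"
  define \<beta> where "\<beta> = (\<lambda>x. inverse (flat_exp 0 (r\<^sup>2)) * flat_exp 0 (\<rho> x))"
  have \<rho>: "\<rho> x = r\<^sup>2 - (dist x z)\<^sup>2" for x
    unfolding \<rho>_def dist_norm power2_norm_eq_inner
      euclidean_inner[of "x - z" "x - z"] by simp
  show "smooth_on UNIV \<beta>"
    unfolding smooth_on_def \<beta>_def
  proof (intro allI C_k_mult open_UNIV C_k_const C_k_compose[OF open_UNIV subset_UNIV _ C_k_flat_exp])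
    show "C_k k UNIV \<rho>" for k
      unfolding \<rho>_def
      by (intro C_k_add C_k_mult C_k_sum C_k_const open_UNIV finite_Basis C_k_id
          C_k_bounded_linear_compose[OF open_UNIV bounded_linear_inner_left])
  qed
  show "\<beta> z = 1"
    using assms by (simp add: \<beta>_def \<rho> flat_exp_def)
  show "\<beta> x = 0" if "x \<notin> cball z r" for x
  proof -
    have "r\<^sup>2 < (dist x z)\<^sup>2"
      using that assms by (intro power_strict_mono) (auto simp: dist_commute)
    then show ?thesis by (simp add: \<beta>_def \<rho> flat_exp_def)
  qed
qed

section \<open>Tangent spaces and vector fields\<close>

locale smooth_manifold =
  fixes A :: "('a::{t2_space, second_countable_topology}, 'e::euclidean_space) chart set"
  assumes smooth_atlas: "smooth_atlas A"
begin

lemma chart_cover: obtains c where "c \<in> A" "p \<in> fst c"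
  using smooth_atlas unfolding smooth_atlas_def by blast

lemma chart:
  assumes "c \<in> A"
  shows open_chart: "open (fst c)"
    and open_chart_image: "open (snd c ` fst c)"
    and chart_inv_chart: "\<And>p. p \<in> fst c \<Longrightarrow> chart_inv c (snd c p) = p"
    and continuous_chart_inv: "continuous_on (snd c ` fst c) (chart_inv c)"
  using assms smooth_atlas by (auto simp: smooth_atlas_def homeomorphism_def)

lemma open_chart_image_Int:
  assumes "c \<in> A" "open U"
  shows "open (snd c ` (fst c \<inter> U))"
proof -
  have "snd c ` (fst c \<inter> U) = snd c ` fst c \<inter> chart_inv c -` U"
    using assms(1) by (auto simp: chart_inv_chart)
  then show ?thesis
    using continuous_open_preimage[OF continuous_chart_inv open_chart_image] assms by simp
qed

lemma smooth_transition:
  assumes "c \<in> A" "d \<in> A"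
  shows "smooth_on (snd c ` (fst c \<inter> fst d)) (snd d \<circ> chart_inv c)"
  using assms smooth_atlas by (auto simp: smooth_atlas_def)

lemma smooth_on_has_derivative:
  "smooth_on S f \<Longrightarrow> x \<in> S \<Longrightarrow> (f has_derivative frechet_derivative f (at x)) (at x)"
  unfolding smooth_on_def by (blast intro: C_k_Suc_has_derivative)

lemma smooth_functionD:
  assumes "f \<in> smooth_functions A" "c \<in> A"
  shows "smooth_on (snd c ` fst c) (f \<circ> chart_inv c)"
  using assms by (auto simp: smooth_functions_def)

lemma smooth_function_has_derivative:
  assumes "f \<in> smooth_functions A" "c \<in> A" "p \<in> fst c"
  shows "((f \<circ> chart_inv c) has_derivative frechet_derivative (f \<circ> chart_inv c) (at (snd c p)))
    (at (snd c p))"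
  using smooth_on_has_derivative[OF smooth_functionD[OF assms(1,2)]] assms(3) by auto

lemma smooth_functions_const: "(\<lambda>_. k) \<in> smooth_functions A"
  by (auto simp: smooth_functions_def smooth_on_def o_def C_k_const)

lemma smooth_functions_add:
  assumes "f \<in> smooth_functions A" "g \<in> smooth_functions A"
  shows "(\<lambda>p. f p + g p) \<in> smooth_functions A"
  using assms C_k_add[OF open_chart_image] unfolding smooth_functions_def smooth_on_def o_def by blast

lemma smooth_functions_mult:
  assumes "f \<in> smooth_functions A" "g \<in> smooth_functions A"
  shows "(\<lambda>p. f p * g p) \<in> smooth_functions A"
  using assms C_k_mult[OF open_chart_image]
  by (simp add: smooth_functions_def smooth_on_def o_def)

lemma coord_vector_linear:
  assumes "c \<in> A" "p \<in> fst c"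
  shows "linear (coord_vector A c p)"
proof (rule linearI)
  fix u v :: 'e and r :: real
  have lin: "linear (frechet_derivative (f \<circ> chart_inv c) (at (snd c p)))"
    if "f \<in> smooth_functions A" for f
    by (rule has_derivative_linear[OF smooth_function_has_derivative[OF that assms]])
  show "coord_vector A c p (u + v) = coord_vector A c p u + coord_vector A c p v"
    by (auto simp: coord_vector_def fun_eq_iff linear_add[OF lin])
  show "coord_vector A c p (r *\<^sub>R u) = r *\<^sub>R coord_vector A c p u"
    by (auto simp: coord_vector_def fun_eq_iff scaleR_fun_def linear_scale[OF lin])
qed

text \<open>
  The chain rule for \<open>f \<circ> d\<inverse> = (f \<circ> c\<inverse>) \<circ> (c \<circ> d\<inverse>)\<close>. It shows that the tangent space, a union over
  all charts around \<open>p\<close>, is already the image of one linear map, hence a vector space.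
\<close>

lemma coord_vector_change_chart:
  assumes "c \<in> A" "d \<in> A" "p \<in> fst c" "p \<in> fst d"
  shows "coord_vector A d p w =
    coord_vector A c p (frechet_derivative (snd c \<circ> chart_inv d) (at (snd d p)) w)"
proof -
  let ?\<tau> = "snd c \<circ> chart_inv d"
  let ?S = "snd d ` (fst d \<inter> fst c)"
  have S: "open ?S" "snd d p \<in> ?S"
    using assms by (auto simp: open_chart_image_Int open_chart)
  have \<tau>: "(?\<tau> has_derivative frechet_derivative ?\<tau> (at (snd d p))) (at (snd d p))"
    by (rule smooth_on_has_derivative[OF smooth_transition S(2)]) (use assms in auto)
  have \<tau>_p: "?\<tau> (snd d p) = snd c p"
    using assms by (simp add: chart_inv_chart)
  have "frechet_derivative (f \<circ> chart_inv d) (at (snd d p)) w =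
     frechet_derivative (f \<circ> chart_inv c) (at (snd c p)) (frechet_derivative ?\<tau> (at (snd d p)) w)"
    if f: "f \<in> smooth_functions A" for f
  proof -
    have "((f \<circ> chart_inv c) has_derivative frechet_derivative (f \<circ> chart_inv c) (at (snd c p)))
        (at (?\<tau> (snd d p)))"
      unfolding \<tau>_p by (rule smooth_function_has_derivative[OF f assms(1,3)])
    from has_derivative_compose[OF \<tau> this]
    have "((f \<circ> chart_inv d) has_derivative
       (\<lambda>w. frechet_derivative (f \<circ> chart_inv c) (at (snd c p))
          (frechet_derivative ?\<tau> (at (snd d p)) w))) (at (snd d p))"
      by (rule has_derivative_transform_within_open[OF _ S])
        (use assms in \<open>auto simp: chart_inv_chart\<close>)
    from frechet_derivative_at[OF this] show ?thesis by (rule fun_cong[OF sym])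
  qed
  then show ?thesis
    by (auto simp: coord_vector_def fun_eq_iff)
qed

lemma tangent_space_eq_range:
  assumes "c \<in> A" "p \<in> fst c"
  shows "tangent_space A p = range (coord_vector A c p)"
proof
  show "range (coord_vector A c p) \<subseteq> tangent_space A p"
    unfolding tangent_space_def using assms by blast
  show "tangent_space A p \<subseteq> range (coord_vector A c p)"
  proof
    fix v assume "v \<in> tangent_space A p"
    then obtain d w where d: "d \<in> A" "p \<in> fst d" "v = coord_vector A d p w"
      by (auto simp: tangent_space_def)
    then show "v \<in> range (coord_vector A c p)"
      using coord_vector_change_chart[OF assms(1) d(1) assms(2) d(2), of w] by blast
  qed
qed

lemma subspace_tangent_space: "subspace (tangent_space A p)"
proof -
  obtain c where c: "c \<in> A" "p \<in> fst c"
    by (rule chart_cover)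
  show ?thesis
    unfolding tangent_space_eq_range[OF c]
    by (rule linear_subspace_image[OF coord_vector_linear[OF c] subspace_UNIV])
qed

lemma vector_field_in_tangent_space: "X \<in> vector_fields A \<Longrightarrow> X p \<in> tangent_space A p"
  by (simp add: vector_fields_def)

lemma vector_fields_add:
  assumes "X \<in> vector_fields A" "Y \<in> vector_fields A"
  shows "X + Y \<in> vector_fields A"
  using assms by (auto simp: vector_fields_def intro: smooth_functions_add
      subspace_add[OF subspace_tangent_space])

lemma vector_fields_smult:
  assumes "f \<in> smooth_functions A" "X \<in> vector_fields A"
  shows "(\<lambda>p. f p *\<^sub>R X p) \<in> vector_fields A"
proof -
  have "(\<lambda>p. (f p *\<^sub>R X p) h) \<in> smooth_functions A" if "h \<in> smooth_functions A" for h
    using assms that by (simp add: vector_fields_def scaleR_fun_def smooth_functions_mult)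
  then show ?thesis
    using assms subspace_scale[OF subspace_tangent_space] by (simp add: vector_fields_def)
qed

lemma vector_field_const:
  assumes "X \<in> vector_fields A"
  shows "X p (\<lambda>_. k) = 0"
  using vector_field_in_tangent_space[OF assms, of p]
  by (auto simp: tangent_space_def coord_vector_def o_def frechet_derivative_const)

text \<open>
  The vector with constant coefficients \<open>w\<close> in a chart is multiplied by a bump function supported in a
  ball whose closure stays inside the chart. The image \<open>K\<close> of the closed ball in the manifold is
  compact, hence closed because the manifold is Hausdorff; so the extension by 0 is smooth: every
  point lies in the chart domain or in the open complement of \<open>K\<close>. This lemma is what turns
  identities for vector fields into identities for tangent vectors.
\<close>

lemma vector_field_through:
  assumes "v \<in> tangent_space A p"
  obtains X where "X \<in> vector_fields A" "X p = v"
proof -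
  obtain c w where c: "c \<in> A" "p \<in> fst c" and v: "v = coord_vector A c p w"
    using assms by (auto simp: tangent_space_def)
  obtain r where r: "r > 0" "cball (snd c p) r \<subseteq> snd c ` fst c"
    using open_chart_image[OF c(1)] c(2) open_contains_cball by (metis imageI)
  obtain \<beta> :: "'e \<Rightarrow> real" where \<beta>: "smooth_on UNIV \<beta>" "\<beta> (snd c p) = 1"
      "\<And>x. x \<notin> cball (snd c p) r \<Longrightarrow> \<beta> x = 0"
    using bump_function[OF r(1), where z = "snd c p"] by metis
  define X where "X = (\<lambda>q. if q \<in> fst c then \<beta> (snd c q) *\<^sub>R coord_vector A c q w else 0)"
  define K where "K = chart_inv c ` cball (snd c p) r"
  have "closed K"
    unfolding K_def
    by (intro compact_imp_closed compact_continuous_image compact_cball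
        continuous_on_subset[OF continuous_chart_inv[OF c(1)] r(2)])
  have X_zero: "X q = 0" if "q \<notin> K" for q
  proof (cases "q \<in> fst c")
    case True
    then have "snd c q \<notin> cball (snd c p) r"
      using that c(1) by (auto simp: K_def image_iff) (metis chart_inv_chart mem_cball)
    then show ?thesis by (simp add: X_def \<beta>(3))
  qed (simp add: X_def)
  have "X q \<in> tangent_space A q" for q
  proof (cases "q \<in> fst c")
    case True
    then have "coord_vector A c q w \<in> tangent_space A q"
      unfolding tangent_space_def using c(1) by blast
    then show ?thesis
      using True subspace_scale[OF subspace_tangent_space] by (simp add: X_def)
  qed (simp add: X_def subspace_0[OF subspace_tangent_space])
  moreover have "(\<lambda>q. X q f) \<in> smooth_functions A" if f: "f \<in> smooth_functions A" for f
  proof -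
    define h where "h = (\<lambda>x. \<beta> x * frechet_derivative (f \<circ> chart_inv c) (at x) w)"
    have h: "C_k k (snd c ` fst c) h" for k
    proof -
      have "C_k (Suc k) (snd c ` fst c) (f \<circ> chart_inv c)"
        using smooth_functionD[OF f c(1)] by (auto simp: smooth_on_def)
      moreover have "C_k k (snd c ` fst c) \<beta>"
        using \<beta>(1) C_k_subset[of k UNIV] by (auto simp: smooth_on_def)
      ultimately show ?thesis
        unfolding h_def by (intro C_k_mult open_chart_image[OF c(1)]) auto
    qed
    have X_h: "X q f = h (snd c q)" if "q \<in> fst c" for q
      using f that by (simp add: X_def h_def coord_vector_def scaleR_fun_def)
    have "C_k k (snd d ` fst d) ((\<lambda>q. X q f) \<circ> chart_inv d)" if d: "d \<in> A" for k d
    proof (rule C_k_local)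
      fix x assume x: "x \<in> snd d ` fst d"
      show "\<exists>U. open U \<and> x \<in> U \<and> C_k k U ((\<lambda>q. X q f) \<circ> chart_inv d)"
      proof (cases "chart_inv d x \<in> fst c")
        case True
        let ?U = "snd d ` (fst d \<inter> fst c)"
        have U: "open ?U"
          by (rule open_chart_image_Int[OF d open_chart[OF c(1)]])
        have "C_k k ?U (\<lambda>y. h ((snd c \<circ> chart_inv d) y))"
        proof (rule C_k_compose[OF U _ _ h])
          show "(snd c \<circ> chart_inv d) ` ?U \<subseteq> snd c ` fst c"
            using d by (auto simp: chart_inv_chart)
          show "C_k k ?U (snd c \<circ> chart_inv d)"
            using smooth_transition[OF d c(1)] by (simp add: smooth_on_def)
        qed
        then have "C_k k ?U ((\<lambda>q. X q f) \<circ> chart_inv d)"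
          by (rule C_k_cong[OF U, rotated]) (use d in \<open>auto simp: chart_inv_chart X_h\<close>)
        moreover have "x \<in> ?U"
          using True x d by (auto simp: chart_inv_chart)
        ultimately show ?thesis using U by blast
      next
        case False
        let ?U = "snd d ` (fst d \<inter> - K)"
        have U: "open ?U"
          using \<open>closed K\<close> by (intro open_chart_image_Int[OF d]) auto
        have "C_k k ?U ((\<lambda>q. X q f) \<circ> chart_inv d)"
          by (rule C_k_cong[OF U _ C_k_const[of _ _ 0]])
            (use d in \<open>auto simp: chart_inv_chart X_zero\<close>)
        moreover have "K \<subseteq> fst c"
          using r(2) chart_inv_chart[OF c(1)] by (force simp: K_def)
        then have "x \<in> ?U"
          using False x d by (auto simp: chart_inv_chart)
        ultimately show ?thesis using U by blast
      qed
    qed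
    then show ?thesis by (auto simp: smooth_functions_def smooth_on_def)
  qed
  ultimately have "X \<in> vector_fields A"
    by (simp add: vector_fields_def)
  moreover have "X p = v"
    using c(2) by (simp add: X_def \<beta>(2) v)
  ultimately show ?thesis by (rule that)
qed

end

section \<open>Algebra of a flat paracontact metric connection\<close>

definition smult :: "('a \<Rightarrow> real) \<Rightarrow> ('a \<Rightarrow> 'v::real_vector) \<Rightarrow> 'a \<Rightarrow> 'v" (infixr "\<odot>" 75) where
  "f \<odot> X = (\<lambda>p. f p *\<^sub>R X p)"

definition linear_operator ::
  "'v::real_vector set \<Rightarrow> ('v \<Rightarrow> 'v) \<Rightarrow> bool" where
  "linear_operator V L \<longleftrightarrow> (\<forall>X\<in>V. L X \<in> V) \<and> linear_on_subspace V L"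

lemma linear_operatorD:
  assumes "subspace V" "linear_operator V L"
  shows linear_operator_closed: "X \<in> V \<Longrightarrow> L X \<in> V"
    and linear_operator_zero: "L 0 = 0"
    and linear_operator_add: "X \<in> V \<Longrightarrow> Y \<in> V \<Longrightarrow> L (X + Y) = L X + L Y"
    and linear_operator_scale: "X \<in> V \<Longrightarrow> L (c *\<^sub>R X) = c *\<^sub>R L X"
    and linear_operator_minus: "X \<in> V \<Longrightarrow> L (- X) = - L X"
    and linear_operator_diff: "X \<in> V \<Longrightarrow> Y \<in> V \<Longrightarrow> L (X - Y) = L X - L Y"
proof -
  have add: "L (X + Y) = L X + L Y" and scale: "L (c *\<^sub>R X) = c *\<^sub>R L X"
    if "X \<in> V" "Y \<in> V" for X Y c
    using assms(2) that by (auto simp: linear_operator_def linear_on_subspace_def)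
  show "L X \<in> V" if "X \<in> V"
    using assms(2) that by (auto simp: linear_operator_def)
  show "L 0 = 0"
    using scale[OF subspace_0 subspace_0, of 0] assms(1) by simp
  show "L (X + Y) = L X + L Y" if "X \<in> V" "Y \<in> V"
    using add that by blast
  show "L (c *\<^sub>R X) = c *\<^sub>R L X" if "X \<in> V"
    using scale that by blast
  show minus: "L (- X) = - L X" if "X \<in> V" for X
    using scale[OF that that, of "- 1"] by simp
  show "L (X - Y) = L X - L Y" if "X \<in> V" "Y \<in> V"
    using add[of X "- Y"] minus[of Y] that subspace_neg[OF assms(1)] by simp
qed

text \<open>
  All transpositions of three letters are conjugate, so one of them cannot act by +1 and another by -1
  on a nonzero expression.
\<close>

lemma sym_skew_zero:
  fixes t :: "'b \<Rightarrow> 'b \<Rightarrow> 'b \<Rightarrow> real"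
  assumes sym: "\<And>x y z. x \<in> S \<Longrightarrow> y \<in> S \<Longrightarrow> z \<in> S \<Longrightarrow> t x y z = t y x z"
    and skew: "\<And>x y z. x \<in> S \<Longrightarrow> y \<in> S \<Longrightarrow> z \<in> S \<Longrightarrow> t x y z = - t x z y"
    and "x \<in> S" "y \<in> S" "z \<in> S"
  shows "t x y z = 0"
  using sym[of x y z] skew[of y x z] sym[of y z x] skew[of z y x] sym[of z x y] skew[of x z y]
    assms(3-) by simp

text \<open>
  \<open>V\<close> plays the role of the vector fields, \<open>F\<close> that of the smooth functions, and \<open>act X f\<close> is the
  derivative of \<open>f\<close> along \<open>X\<close>. The 1-form \<open>\<eta>\<close> appears only as \<open>G X \<xi>\<close>, and the Lie bracket only as
  \<open>D X Y - D Y X\<close>; with this the equation \<open>g(X, \<phi> Y) = d\<eta>(X, Y)\<close> takes the form \<open>contact\<close>. Working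
  with global fields throughout keeps every identity an equation in one module.
\<close>

locale flat_paracontact_module =
  fixes V :: "('a \<Rightarrow> 'v::real_vector) set"
    and F :: "('a \<Rightarrow> real) set"
    and G :: "('a \<Rightarrow> 'v) \<Rightarrow> ('a \<Rightarrow> 'v) \<Rightarrow> 'a \<Rightarrow> real"
    and act :: "('a \<Rightarrow> 'v) \<Rightarrow> ('a \<Rightarrow> real) \<Rightarrow> 'a \<Rightarrow> real"
    and D :: "('a \<Rightarrow> 'v) \<Rightarrow> ('a \<Rightarrow> 'v) \<Rightarrow> 'a \<Rightarrow> 'v"
    and \<Phi> :: "('a \<Rightarrow> 'v) \<Rightarrow> 'a \<Rightarrow> 'v"
    and \<xi> :: "'a \<Rightarrow> 'v"
  assumes V_add: "X \<in> V \<Longrightarrow> Y \<in> V \<Longrightarrow> X + Y \<in> V"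
    and V_smult: "f \<in> F \<Longrightarrow> X \<in> V \<Longrightarrow> f \<odot> X \<in> V"
    and F_const: "(\<lambda>_. k) \<in> F"
    and F_metric: "X \<in> V \<Longrightarrow> Y \<in> V \<Longrightarrow> G X Y \<in> F"
    and \<xi>_V: "\<xi> \<in> V"
    and G_add: "X \<in> V \<Longrightarrow> Y \<in> V \<Longrightarrow> Z \<in> V \<Longrightarrow> G (X + Y) Z p = G X Z p + G Y Z p"
    and G_smult: "f \<in> F \<Longrightarrow> X \<in> V \<Longrightarrow> Z \<in> V \<Longrightarrow> G (f \<odot> X) Z p = f p * G X Z p"
    and G_sym: "X \<in> V \<Longrightarrow> Y \<in> V \<Longrightarrow> G X Y = G Y X"
    and G_nondegenerate: "X \<in> V \<Longrightarrow> (\<And>Y. Y \<in> V \<Longrightarrow> G X Y p = 0) \<Longrightarrow> X p = 0"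
    and act_const: "X \<in> V \<Longrightarrow> act X (\<lambda>_. k) p = 0"
    and act_F: "X \<in> V \<Longrightarrow> f \<in> F \<Longrightarrow> act X f \<in> F"
    and D_V: "X \<in> V \<Longrightarrow> Y \<in> V \<Longrightarrow> D X Y \<in> V"
    and D_add_left: "X \<in> V \<Longrightarrow> Y \<in> V \<Longrightarrow> Z \<in> V \<Longrightarrow> D (X + Y) Z = D X Z + D Y Z"
    and D_add_right: "X \<in> V \<Longrightarrow> Y \<in> V \<Longrightarrow> Z \<in> V \<Longrightarrow> D X (Y + Z) = D X Y + D X Z"
    and D_smult_left: "f \<in> F \<Longrightarrow> X \<in> V \<Longrightarrow> Y \<in> V \<Longrightarrow> D (f \<odot> X) Y = f \<odot> D X Y"
    and D_smult_right: "f \<in> F \<Longrightarrow> X \<in> V \<Longrightarrow> Y \<in> V \<Longrightarrow> D X (f \<odot> Y) = act X f \<odot> Y + f \<odot> D X Y"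
    and D_metric: "X \<in> V \<Longrightarrow> Y \<in> V \<Longrightarrow> Z \<in> V \<Longrightarrow>
      act X (G Y Z) p = G (D X Y) Z p + G Y (D X Z) p"
    and flat: "X \<in> V \<Longrightarrow> Y \<in> V \<Longrightarrow> Z \<in> V \<Longrightarrow>
      D X (D Y Z) - D Y (D X Z) - D (D X Y - D Y X) Z = 0"
    and \<Phi>_V: "X \<in> V \<Longrightarrow> \<Phi> X \<in> V"
    and \<Phi>_add: "X \<in> V \<Longrightarrow> Y \<in> V \<Longrightarrow> \<Phi> (X + Y) = \<Phi> X + \<Phi> Y"
    and \<Phi>_smult: "f \<in> F \<Longrightarrow> X \<in> V \<Longrightarrow> \<Phi> (f \<odot> X) = f \<odot> \<Phi> X"
    and \<Phi>_\<xi>: "\<Phi> \<xi> = 0"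
    and G_\<Phi>_\<xi>: "X \<in> V \<Longrightarrow> G (\<Phi> X) \<xi> p = 0"
    and G_\<xi>_\<xi>: "G \<xi> \<xi> p = 1"
    and \<Phi>_\<Phi>: "X \<in> V \<Longrightarrow> \<Phi> (\<Phi> X) = X - G X \<xi> \<odot> \<xi>"
    and contact: "X \<in> V \<Longrightarrow> Y \<in> V \<Longrightarrow> G (D X \<xi>) Y p - G (D Y \<xi>) X p = 2 * G X (\<Phi> Y) p"
begin

lemma scale_eq_smult: "c *\<^sub>R X = (\<lambda>_. c) \<odot> X"
  by (simp add: smult_def scaleR_fun_def)

lemma smult_zero [simp]: "f \<odot> 0 = 0" "(\<lambda>_. 0) \<odot> X = 0"
  by (auto simp: smult_def fun_eq_iff)

lemma subspace_V: "subspace V"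
proof (rule subspaceI)
  show "c *\<^sub>R X \<in> V" if "X \<in> V" for c X
    using V_smult[OF F_const that] by (simp add: scale_eq_smult)
  from this[OF \<xi>_V, of 0] show "0 \<in> V" by simp
qed (rule V_add)

lemmas V_closed = \<xi>_V D_V \<Phi>_V subspace_0[OF subspace_V] subspace_add[OF subspace_V]
  subspace_diff[OF subspace_V] subspace_neg[OF subspace_V] subspace_scale[OF subspace_V]

declare V_closed [simp]

text \<open>
  Since \<open>contact\<close> says that the skew part of \<open>a = \<nabla>\<xi>\<close> is \<open>-\<Phi>\<close>, the operator \<open>b = a + 2 \<Phi>\<close> is the adjoint of
  \<open>a\<close> with respect to \<open>G\<close>, and \<open>s = a + \<Phi>\<close>, defined further down, is the symmetric part of \<open>a\<close>.
\<close>

definition a :: "('a \<Rightarrow> 'v) \<Rightarrow> 'a \<Rightarrow> 'v" where "a X = D X \<xi>"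

definition b :: "('a \<Rightarrow> 'v) \<Rightarrow> 'a \<Rightarrow> 'v" where "b X = a X + 2 *\<^sub>R \<Phi> X"

lemma linear_D: "X \<in> V \<Longrightarrow> linear_operator V (D X)"
  unfolding linear_operator_def linear_on_subspace_def
  by (auto simp: D_add_right scale_eq_smult D_smult_right F_const)
    (auto simp: smult_def act_const)

lemma linear_\<Phi>: "linear_operator V \<Phi>"
  unfolding linear_operator_def linear_on_subspace_def
  by (auto simp: \<Phi>_add scale_eq_smult \<Phi>_smult F_const)

lemma linear_a: "linear_operator V a"
  unfolding linear_operator_def linear_on_subspace_def a_def
  by (auto simp: D_add_left scale_eq_smult D_smult_left F_const)

lemma a_V [simp]: "X \<in> V \<Longrightarrow> a X \<in> V" by (simp add: a_def)
lemma b_V [simp]: "X \<in> V \<Longrightarrow> b X \<in> V" by (simp add: b_def)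

lemmas D_linear = linear_operatorD(2-)[OF subspace_V linear_D]
lemmas \<Phi>_linear = linear_operatorD(2-)[OF subspace_V linear_\<Phi>]
lemmas a_linear = linear_operatorD(2-)[OF subspace_V linear_a]

lemma linear_b: "linear_operator V b"
  unfolding linear_operator_def linear_on_subspace_def b_def
  by (auto simp: \<Phi>_linear a_linear algebra_simps)

lemmas b_linear = linear_operatorD(2-)[OF subspace_V linear_b]

declare D_linear [simp] \<Phi>_linear [simp] a_linear [simp] b_linear [simp]

lemma G_scale_left: "X \<in> V \<Longrightarrow> Z \<in> V \<Longrightarrow> G (c *\<^sub>R X) Z p = c * G X Z p"
  by (simp add: scale_eq_smult G_smult F_const)

lemma G_linear_left [simp]:
  assumes "X \<in> V" "Y \<in> V" "Z \<in> V"
  shows "G (X + Y) Z p = G X Z p + G Y Z p" "G (X - Y) Z p = G X Z p - G Y Z p"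
    "G (- X) Z p = - G X Z p" "G (c *\<^sub>R X) Z p = c * G X Z p" "G 0 Z p = 0"
  using G_add[of X "- Y" Z p] G_scale_left[of Y Z "- 1" p] G_scale_left[of X Z "- 1" p]
    G_scale_left[of X Z 0 p] assms by (auto simp: G_add G_scale_left)

lemma G_linear_right [simp]:
  assumes "X \<in> V" "Y \<in> V" "Z \<in> V"
  shows "G Z (X + Y) p = G Z X p + G Z Y p" "G Z (X - Y) p = G Z X p - G Z Y p"
    "G Z (- X) p = - G Z X p" "G Z (c *\<^sub>R X) p = c * G Z X p" "G Z 0 p = 0"
  using assms by (simp_all add: G_sym[of Z])

lemma zeroI:
  assumes "X \<in> V" "\<And>Y p. Y \<in> V \<Longrightarrow> G X Y p = 0"
  shows "X = 0"
  using G_nondegenerate[OF assms(1)] assms(2) by (auto simp: fun_eq_iff)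

lemma G_\<xi>_\<Phi> [simp]: "X \<in> V \<Longrightarrow> G \<xi> (\<Phi> X) p = 0"
  using G_sym[of \<xi> "\<Phi> X"] G_\<Phi>_\<xi> by simp

declare G_\<Phi>_\<xi> [simp] G_\<xi>_\<xi> [simp] \<Phi>_\<xi> [simp]

lemma G_a_\<xi> [simp]: "X \<in> V \<Longrightarrow> G (a X) \<xi> p = 0"
proof -
  assume X: "X \<in> V"
  have "act X (G \<xi> \<xi>) p = 0"
    using act_const[OF X, of 1 p] G_\<xi>_\<xi> by (metis ext)
  then show ?thesis
    using D_metric[OF X \<xi>_V \<xi>_V, of p] G_sym[of "D X \<xi>" \<xi>] X by (simp add: a_def)
qed

lemma G_a_b: "X \<in> V \<Longrightarrow> Y \<in> V \<Longrightarrow> G (a X) Y p = G X (b Y) p"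
  using contact[of X Y p] G_sym[of "a Y" X] by (simp add: a_def[symmetric] b_def)

lemma G_b_a: "X \<in> V \<Longrightarrow> Y \<in> V \<Longrightarrow> G (b X) Y p = G X (a Y) p"
  using G_a_b[of Y X p] G_sym[of "a Y" X] G_sym[of "b X" Y] by simp

lemma G_b_\<xi> [simp]: "X \<in> V \<Longrightarrow> G (b X) \<xi> p = 0"
  by (simp add: b_def)

lemma G_\<xi>_a [simp]: "X \<in> V \<Longrightarrow> G \<xi> (a X) p = 0"
  using G_sym[of \<xi> "a X"] by simp

lemma G_\<xi>_b [simp]: "X \<in> V \<Longrightarrow> G \<xi> (b X) p = 0"
  using G_sym[of \<xi> "b X"] by simp

lemma a_\<xi> [simp]: "a \<xi> = 0"
proof (rule zeroI)
  show "G (a \<xi>) Y p = 0" if "Y \<in> V" for Y p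
    using G_a_b[of \<xi> Y p] that by simp
qed simp

lemma a_smult: "f \<in> F \<Longrightarrow> X \<in> V \<Longrightarrow> a (f \<odot> X) = f \<odot> a X"
  by (simp add: a_def D_smult_left)

lemma \<Phi>_\<Phi>_horizontal:
  assumes "X \<in> V" "\<And>p. G X \<xi> p = 0"
  shows "\<Phi> (\<Phi> X) = X"
proof -
  have "G X \<xi> = (\<lambda>_. 0)" using assms(2) by blast
  then show ?thesis using \<Phi>_\<Phi>[OF assms(1)] by simp
qed

definition s where "s X = a X + \<Phi> X"

text \<open>
  The covariant derivatives \<open>(\<nabla>\<^sub>X a) Y\<close>, \<open>(\<nabla>\<^sub>X b) Y\<close> and \<open>(\<nabla>\<^sub>X \<Phi>) Y\<close> of the three operators.
\<close>

definition Da where "Da X Y = D X (a Y) - a (D X Y)"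
definition Db where "Db X Y = D X (b Y) - b (D X Y)"
definition D\<Phi> where "D\<Phi> X Y = D X (\<Phi> Y) - \<Phi> (D X Y)"

lemma Da_V [simp]: "X \<in> V \<Longrightarrow> Y \<in> V \<Longrightarrow> Da X Y \<in> V" by (simp add: Da_def)
lemma Db_V [simp]: "X \<in> V \<Longrightarrow> Y \<in> V \<Longrightarrow> Db X Y \<in> V" by (simp add: Db_def)
lemma D\<Phi>_V [simp]: "X \<in> V \<Longrightarrow> Y \<in> V \<Longrightarrow> D\<Phi> X Y \<in> V" by (simp add: D\<Phi>_def)

text \<open>
  The Codazzi equation: the difference of the two sides is the curvature applied to \<open>\<xi>\<close>.
\<close>

lemma Da_sym: "X \<in> V \<Longrightarrow> Y \<in> V \<Longrightarrow> Da X Y = Da Y X"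
  using flat[of X Y \<xi>] by (simp add: Da_def a_def[symmetric] algebra_simps)

lemma Da_\<xi>_right: "X \<in> V \<Longrightarrow> Da X \<xi> = - a (a X)"
  by (simp add: Da_def) (simp add: a_def)

lemma Da_\<xi>_left: "X \<in> V \<Longrightarrow> Da \<xi> X = - a (a X)"
  using Da_sym[of \<xi> X] Da_\<xi>_right by simp

lemma Db_eq: "X \<in> V \<Longrightarrow> Y \<in> V \<Longrightarrow> Db X Y = Da X Y + 2 *\<^sub>R D\<Phi> X Y"
  by (simp add: Da_def Db_def D\<Phi>_def b_def algebra_simps)

lemma G_Da_Db:
  assumes "X \<in> V" "Y \<in> V" "Z \<in> V"
  shows "G (Da X Y) Z p = G Y (Db X Z) p"
proof -
  have "G (a Y) Z = G Y (b Z)"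
    using G_a_b assms by blast
  then have "G (D X (a Y)) Z p + G (a Y) (D X Z) p = G (D X Y) (b Z) p + G Y (D X (b Z)) p"
    using D_metric[of X "a Y" Z p] D_metric[of X Y "b Z" p] assms by simp
  then show ?thesis
    using assms by (simp add: Da_def Db_def G_a_b)
qed

lemma Db_\<xi>_left: "X \<in> V \<Longrightarrow> Db \<xi> X = - b (b X)"
proof -
  assume X: "X \<in> V"
  have "Db \<xi> X + b (b X) = 0"
  proof (rule zeroI)
    show "G (Db \<xi> X + b (b X)) Y p = 0" if "Y \<in> V" for Y p
      using X that G_Da_Db[of \<xi> Y X p] G_sym[of Y "Db \<xi> X"] G_sym[of Y "b (b X)"]
      by (simp add: Da_\<xi>_left G_a_b)
  qed (use X in simp)
  then show ?thesis by (simp add: eq_neg_iff_add_eq_0)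
qed

lemma \<eta>_\<xi>_V [simp]: "X \<in> V \<Longrightarrow> G X \<xi> \<odot> \<xi> \<in> V"
  by (simp add: V_smult F_metric)

text \<open>
  The derivative along \<open>X\<close> of the identity \<open>\<Phi>\<^sup>2 = id - \<eta> \<otimes> \<xi>\<close>.
\<close>

lemma D\<Phi>_square:
  assumes "X \<in> V" "Y \<in> V"
  shows "D\<Phi> X (\<Phi> Y) + \<Phi> (D\<Phi> X Y) = - (G Y (a X) \<odot> \<xi>) - G Y \<xi> \<odot> a X"
proof -
  have "D\<Phi> X (\<Phi> Y) + \<Phi> (D\<Phi> X Y) = D X (\<Phi> (\<Phi> Y)) - \<Phi> (\<Phi> (D X Y))"
    using assms by (simp add: D\<Phi>_def)
  also have "\<dots> = G (D X Y) \<xi> \<odot> \<xi> - D X (G Y \<xi> \<odot> \<xi>)"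
    using assms by (simp add: \<Phi>_\<Phi>)
  also have "\<dots> = - (G Y (a X) \<odot> \<xi>) - G Y \<xi> \<odot> a X"
    using assms by (simp add: D_smult_right F_metric a_def[symmetric])
      (auto simp: smult_def fun_eq_iff D_metric a_def[symmetric] algebra_simps)
  finally show ?thesis .
qed

lemma s_V [simp]: "X \<in> V \<Longrightarrow> s X \<in> V" by (simp add: s_def)

lemma linear_s: "linear_operator V s"
  unfolding linear_operator_def linear_on_subspace_def s_def
  by (auto simp: algebra_simps)

lemmas s_linear = linear_operatorD(2-)[OF subspace_V linear_s]
declare s_linear [simp]

lemma G_s_\<xi> [simp]: "X \<in> V \<Longrightarrow> G (s X) \<xi> p = 0"
  by (simp add: s_def)

lemma \<Phi>_\<Phi>_a [simp]: "X \<in> V \<Longrightarrow> \<Phi> (\<Phi> (a X)) = a X"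
  and \<Phi>_\<Phi>_b [simp]: "X \<in> V \<Longrightarrow> \<Phi> (\<Phi> (b X)) = b X"
  and \<Phi>_\<Phi>_s [simp]: "X \<in> V \<Longrightarrow> \<Phi> (\<Phi> (s X)) = s X"
  and \<Phi>_\<Phi>_\<Phi> [simp]: "X \<in> V \<Longrightarrow> \<Phi> (\<Phi> (\<Phi> X)) = \<Phi> X"
  by (simp_all add: \<Phi>_\<Phi>_horizontal)

lemma a_\<Phi>_\<Phi> [simp]: "X \<in> V \<Longrightarrow> a (\<Phi> (\<Phi> X)) = a X"
  by (simp add: \<Phi>_\<Phi> a_smult F_metric)

lemma b_\<Phi>_\<Phi> [simp]: "X \<in> V \<Longrightarrow> b (\<Phi> (\<Phi> X)) = b X"
  by (simp add: b_def)

lemma s_\<Phi>_\<Phi> [simp]: "X \<in> V \<Longrightarrow> s (\<Phi> (\<Phi> X)) = s X"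
  by (simp add: s_def)

lemma D\<Phi>_\<xi>_eq: "X \<in> V \<Longrightarrow> D\<Phi> \<xi> X = - (s (\<Phi> X) + \<Phi> (s X))"
proof -
  assume X: "X \<in> V"
  have "2 *\<^sub>R D\<Phi> \<xi> X = a (a X) - b (b X)"
    using Db_eq[of \<xi> X] X by (simp add: Da_\<xi>_left Db_\<xi>_left algebra_simps)
  also have "\<dots> = 2 *\<^sub>R (- (s (\<Phi> X) + \<Phi> (s X)))"
    using X by (simp add: b_def s_def algebra_simps scaleR_2)
  finally show ?thesis by (metis real_vector.scale_cancel_left zero_neq_numeral)
qed

lemma G_zero_right [simp]: "X \<in> V \<Longrightarrow> G X 0 = (\<lambda>_. 0)"
  using G_linear_right(5) \<xi>_V by blast

text \<open>
  Along \<open>\<xi>\<close> the Codazzi equation gives \<open>\<nabla>\<^sub>\<xi> a = -a\<^sup>2\<close> and, by taking adjoints, \<open>\<nabla>\<^sub>\<xi> b = -b\<^sup>2\<close>, so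
  \<open>\<nabla>\<^sub>\<xi> \<Phi> = (a\<^sup>2 - b\<^sup>2) / 2 = -(s \<Phi> + \<Phi> s)\<close>. Differentiating \<open>\<Phi>\<^sup>2 = id - \<eta> \<otimes> \<xi>\<close> along \<open>\<xi>\<close>, where the
  right-hand side is parallel, forces \<open>s + \<Phi> s \<Phi> = 0\<close>; composing with \<open>\<Phi>\<close> yields the claim. In
  particular \<open>\<Phi>\<close> is parallel along \<open>\<xi>\<close>.
\<close>

lemma s_\<Phi>: "X \<in> V \<Longrightarrow> s (\<Phi> X) = - \<Phi> (s X)"
proof -
  assume X: "X \<in> V"
  have "D\<Phi> \<xi> (\<Phi> X) + \<Phi> (D\<Phi> \<xi> X) = 0"
    using D\<Phi>_square[OF \<xi>_V X] X by simp
  moreover have "2 *\<^sub>R (s X + \<Phi> (s (\<Phi> X))) = - (D\<Phi> \<xi> (\<Phi> X) + \<Phi> (D\<Phi> \<xi> X))"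
    using X by (simp add: D\<Phi>_\<xi>_eq algebra_simps scaleR_2)
  ultimately have "2 *\<^sub>R (s X + \<Phi> (s (\<Phi> X))) = 0"
    by simp
  then have "s X + \<Phi> (s (\<Phi> X)) = 0"
    by (metis real_vector.scale_eq_0_iff zero_neq_numeral)
  then have "\<Phi> (s X + \<Phi> (s (\<Phi> X))) = 0" by simp
  then show ?thesis
    using X by (simp add: eq_neg_iff_add_eq_0 add.commute)
qed

lemma D_\<xi>_\<Phi>: "X \<in> V \<Longrightarrow> D \<xi> (\<Phi> X) = \<Phi> (D \<xi> X)"
  using D\<Phi>_\<xi>_eq[of X] by (simp add: s_\<Phi> D\<Phi>_def)

text \<open>
  Differentiating \<open>s \<Phi> + \<Phi> s = 0\<close> along \<open>\<xi>\<close>, with \<open>\<nabla>\<^sub>\<xi> s = -a\<^sup>2\<close> and \<open>\<nabla>\<^sub>\<xi> \<Phi> = 0\<close>, shows that \<open>a\<^sup>2\<close>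
  anticommutes with \<open>\<Phi>\<close>. But \<open>a\<^sup>2 = s\<^sup>2 + \<Phi>\<^sup>2\<close> also commutes with \<open>\<Phi>\<close>, which is invertible on the
  horizontal distribution.
\<close>

lemma a_a [simp]: "X \<in> V \<Longrightarrow> a (a X) = 0"
proof -
  assume X: "X \<in> V"
  have aa: "a (a Y) = s (s Y) + \<Phi> (\<Phi> Y)" if "Y \<in> V" for Y
  proof -
    have a: "a Z = s Z - \<Phi> Z" for Z
      by (simp add: s_def)
    show ?thesis
      using that unfolding a by (simp add: s_\<Phi>)
  qed
  have D_s: "D \<xi> (s Y) = s (D \<xi> Y) - a (a Y)" if "Y \<in> V" for Y
    using Da_\<xi>_left[OF that] that by (simp add: s_def Da_def D_\<xi>_\<Phi> algebra_simps)
  have "a (a (\<Phi> X)) + \<Phi> (a (a X)) = - (D \<xi> (s (\<Phi> X)) + D \<xi> (\<Phi> (s X)))"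
    using X by (simp only: D_s D_\<xi>_\<Phi> s_V \<Phi>_V) (simp add: D_\<xi>_\<Phi> s_\<Phi> algebra_simps)
  then have "a (a (\<Phi> X)) + \<Phi> (a (a X)) = 0"
    using X by (simp add: s_\<Phi>)
  moreover have "a (a (\<Phi> X)) = \<Phi> (a (a X))"
    using X by (simp add: aa s_\<Phi>)
  ultimately have "2 *\<^sub>R \<Phi> (a (a X)) = 0"
    by (simp add: scaleR_2)
  then have "\<Phi> (a (a X)) = 0"
    by (metis real_vector.scale_eq_0_iff zero_neq_numeral)
  then show ?thesis
    using X \<Phi>_\<Phi>_a[of "a X"] \<Phi>_linear(2) by simp
qed

lemma b_b [simp]: "X \<in> V \<Longrightarrow> b (b X) = 0"
  using Db_eq[of \<xi> X] Da_\<xi>_left[of X] Db_\<xi>_left[of X] by (simp add: D\<Phi>_\<xi>_eq s_\<Phi>)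

text \<open>
  A Clifford relation between the nilpotent operators \<open>a\<close> and \<open>b\<close>: the horizontal distribution is the
  direct sum of the images of \<open>ab\<close> and \<open>ba\<close>.
\<close>

lemma a_b_plus_b_a: "X \<in> V \<Longrightarrow> a (b X) + b (a X) = - 4 *\<^sub>R \<Phi> (\<Phi> X)"
proof -
  assume X: "X \<in> V"
  have *: "a (\<Phi> X) + \<Phi> (a X) = - 2 *\<^sub>R \<Phi> (\<Phi> X)"
    using s_\<Phi>[OF X] X by (simp add: s_def scaleR_2 algebra_simps eq_neg_iff_add_eq_0)
  have "a (b X) + b (a X) = 2 *\<^sub>R (a (\<Phi> X) + \<Phi> (a X))"
    using X by (simp add: b_def algebra_simps)
  then show ?thesis unfolding * by simp
qed

lemma a_b_a [simp]: "X \<in> V \<Longrightarrow> a (b (a X)) = - 4 *\<^sub>R a X"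
  using a_b_plus_b_a[of "a X"] by simp

lemma b_a_b [simp]: "X \<in> V \<Longrightarrow> b (a (b X)) = - 4 *\<^sub>R b X"
  using a_b_plus_b_a[of "b X"] by simp

lemma Da_a: "X \<in> V \<Longrightarrow> Y \<in> V \<Longrightarrow> Da X (a Y) = - a (Da X Y)"
  by (simp add: Da_def)

lemma G_Da_\<xi>: "X \<in> V \<Longrightarrow> Y \<in> V \<Longrightarrow> G (Da X Y) \<xi> p = - G (a X) (a Y) p"
proof -
  assume XY: "X \<in> V" "Y \<in> V"
  have "G (a Y) \<xi> = (\<lambda>_. 0)" using XY by auto
  then show ?thesis
    using D_metric[of X "a Y" \<xi> p] act_const[of X 0 p] G_sym[of "a Y" "a X"] XY
    by (simp add: Da_def a_def[symmetric])
qed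

lemma Da_a_b_plus_b_a:
  assumes "X \<in> V" "Y \<in> V"
  shows "Da X (b Y) + a (Db X Y) + Db X (a Y) + b (Da X Y) =
    4 *\<^sub>R (G Y (a X) \<odot> \<xi> + G Y \<xi> \<odot> a X)"
proof -
  have "Da X (b Y) + a (Db X Y) + Db X (a Y) + b (Da X Y) =
      D X (a (b Y) + b (a Y)) - (a (b (D X Y)) + b (a (D X Y)))"
    using assms by (simp add: Da_def Db_def algebra_simps)
  also have "\<dots> = - 4 *\<^sub>R (D\<Phi> X (\<Phi> Y) + \<Phi> (D\<Phi> X Y))"
    using assms by (simp add: a_b_plus_b_a D\<Phi>_def algebra_simps del: D_linear(2))
  also have "\<dots> = 4 *\<^sub>R (G Y (a X) \<odot> \<xi> + G Y \<xi> \<odot> a X)"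
    unfolding D\<Phi>_square[OF assms] by (simp add: algebra_simps)
  finally show ?thesis .
qed

text \<open>
  The derivative of the relation \<open>ab + ba = -4 \<Phi>\<^sup>2\<close>, evaluated at \<open>b Y\<close> and paired
  with \<open>b Z\<close>: two of the four terms on the left vanish because \<open>b\<^sup>2 = 0\<close>, and the right-hand side
  vanishes because the image of \<open>b\<close> is orthogonal to \<open>\<xi>\<close>.
\<close>

lemma G_Da_skew:
  assumes "X \<in> V" "Y \<in> V" "Z \<in> V"
  shows "G (Da X (b Y)) (a (b Z)) p = - G (Da X (b Z)) (a (b Y)) p"
proof -
  have eq: "a (Db X (b Y)) + Db X (a (b Y)) + b (Da X (b Y)) = 
     4 *\<^sub>R (G (b Y) (a X) \<odot> \<xi>)"
  proof -
    have "G (b Y) \<xi> = (\<lambda>_. 0)" using assms by auto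
    moreover have "Da X 0 = 0" using assms by (simp add: Da_def)
    ultimately show ?thesis
      using Da_a_b_plus_b_a[of X "b Y"] assms by simp
  qed
  have "G (a (Db X (b Y)) + Db X (a (b Y)) + b (Da X (b Y))) (b Z) p = 0"
    unfolding eq using assms by (simp add: V_smult F_metric G_smult)
  then have "G (Db X (a (b Y))) (b Z) p + G (Da X (b Y)) (a (b Z)) p = 0"
    using assms by (simp add: G_a_b G_b_a del: b_b) simp
  moreover have "G (Db X (a (b Y))) (b Z) p = G (Da X (b Z)) (a (b Y)) p"
    using G_Da_Db[of X "b Z" "a (b Y)" p] G_sym[of "b Z" "Db X (a (b Y))"] assms by simp
  ultimately show ?thesis by simp
qed

text \<open>
  Here \<open>G_Da_skew\<close> is used in direction \<open>ab X\<close>. By the Codazzi equation and \<open>a\<^sup>2 = 0\<close>, \<open>\<nabla>\<^sub>a\<^sub>b\<^sub>X a\<close> is \<open>-a\<close>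
  composed with \<open>\<nabla>\<^sub>b\<^sub>X a\<close> on the image of \<open>b\<close>, and moving this \<open>a\<close> to the other side of \<open>G\<close> gives \<open>bab = -4 b\<close>. So
  the expression, symmetric in \<open>X\<close> and \<open>Y\<close>, is also skew in \<open>Y\<close> and \<open>Z\<close>.
\<close>

lemma G_Da_b_b_b:
  assumes "X \<in> V" "Y \<in> V" "Z \<in> V"
  shows "G (Da (b X) (b Y)) (b Z) p = 0"
proof (rule sym_skew_zero[of V "\<lambda>X Y Z. G (Da (b X) (b Y)) (b Z) p"])
  fix X Y Z assume XYZ: "X \<in> V" "Y \<in> V" "Z \<in> V"
  have *: "G (Da (a (b X)) (b Y)) (a (b Z)) p = 4 * G (Da (b X) (b Y)) (b Z) p"
    if "Y \<in> V" "Z \<in> V" for Y Z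
  proof -
    have "Da (a (b X)) (b Y) = - a (Da (b X) (b Y))"
      using Da_sym[of "a (b X)" "b Y"] Da_sym[of "b X" "b Y"] Da_a[of "b Y" "b X"] XYZ that by simp
    then show ?thesis
      using XYZ that by (simp add: G_a_b)
  qed
  show "G (Da (b X) (b Y)) (b Z) p = - G (Da (b X) (b Z)) (b Y) p"
    using G_Da_skew[of "a (b X)" Y Z p] *[of Y Z] *[of Z Y] XYZ by simp
  show "G (Da (b X) (b Y)) (b Z) p = G (Da (b Y) (b X)) (b Z) p"
    using Da_sym[of "b X" "b Y"] XYZ by simp
qed (use assms in auto)

lemma G_Da_b_b_a_b:
  assumes "X \<in> V" "Y \<in> V" "Z \<in> V"
  shows "G (Da (b X) (b Y)) (a (b Z)) p = 0"
proof (rule sym_skew_zero[of V "\<lambda>X Y Z. G (Da (b X) (b Y)) (a (b Z)) p"])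
  fix X Y Z assume XYZ: "X \<in> V" "Y \<in> V" "Z \<in> V"
  show "G (Da (b X) (b Y)) (a (b Z)) p = - G (Da (b X) (b Z)) (a (b Y)) p"
    using G_Da_skew[of "b X" Y Z p] XYZ by simp
  show "G (Da (b X) (b Y)) (a (b Z)) p = G (Da (b Y) (b X)) (a (b Z)) p"
    using Da_sym[of "b X" "b Y"] XYZ by simp
qed (use assms in auto)

text \<open>
  The two preceding lemmas say that \<open>(\<nabla>\<^sub>b\<^sub>X a) (b Y)\<close> is orthogonal to the images of \<open>b\<close> and of \<open>ab\<close>,
  which together make up the horizontal distribution; only the \<open>\<xi>\<close>-component is left.
\<close>

lemma Da_b_b:
  assumes "X \<in> V" "Y \<in> V"
  shows "Da (b X) (b Y) = - (G (a (b X)) (a (b Y)) \<odot> \<xi>)"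
proof -
  let ?T = "Da (b X) (b Y)"
  let ?f = "G (a (b X)) (a (b Y))"
  have f: "?f \<odot> \<xi> \<in> V" using assms by (simp add: V_smult F_metric)
  have "?T + ?f \<odot> \<xi> = 0"
  proof (rule zeroI)
    fix Z p assume Z: "Z \<in> V"
    have "G ?T (- 4 *\<^sub>R \<Phi> (\<Phi> Z)) p = 0"
      unfolding a_b_plus_b_a[OF Z, symmetric] using assms Z
      by (simp add: G_Da_b_b_b G_Da_b_b_a_b)
    then have "G ?T (\<Phi> (\<Phi> Z)) p = 0"
      using assms Z by simp
    moreover have "G ?T (G Z \<xi> \<odot> \<xi>) p = G Z \<xi> p * G ?T \<xi> p"
      using assms Z G_sym[of ?T "G Z \<xi> \<odot> \<xi>"] G_sym[of ?T \<xi>] by (simp add: G_smult F_metric)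
    ultimately have "G ?T Z p = - (G Z \<xi> p * ?f p)"
      using assms Z by (simp add: \<Phi>_\<Phi> G_Da_\<xi>)
    moreover have "G (?f \<odot> \<xi>) Z p = ?f p * G Z \<xi> p"
      using assms Z G_sym[of Z \<xi>] by (simp add: G_smult F_metric)
    ultimately show "G (?T + ?f \<odot> \<xi>) Z p = 0"
      using assms Z f by simp
  qed (use assms f in simp)
  then show ?thesis by (simp add: eq_neg_iff_add_eq_0)
qed

lemma Da_\<Phi>_\<Phi>:
  assumes "X \<in> V" "Y \<in> V"
  shows "Da X (\<Phi> (\<Phi> Y)) = Da X Y"
proof -
  have "Da X (G Y \<xi> \<odot> \<xi>) = 0"
    using assms by (simp add: Da_def a_smult F_metric D_smult_right act_F V_smult)
      (simp add: a_def[symmetric])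
  then show ?thesis
    using assms by (simp add: \<Phi>_\<Phi> Da_def)
qed

lemma Da_a_b_b_a:
  assumes "X \<in> V" "Y \<in> V"
  shows "Da X (a (b Y)) + Da X (b (a Y)) = - 4 *\<^sub>R Da X Y"
proof -
  have "Da X (a (b Y)) + Da X (b (a Y)) = Da X (a (b Y) + b (a Y))"
    using assms by (simp add: Da_def algebra_simps)
  also have "\<dots> = - 4 *\<^sub>R Da X (\<Phi> (\<Phi> Y))"
    unfolding a_b_plus_b_a[OF assms(2)] using assms by (simp add: Da_def algebra_simps)
  finally show ?thesis using Da_\<Phi>_\<Phi>[OF assms] by simp
qed

text \<open>
  Splitting both arguments by \<open>ab + ba = -4 \<Phi>\<^sup>2\<close>, the parts in the image of \<open>a\<close> contribute nothing, since
  \<open>(\<nabla>\<^sub>X a) a = - a (\<nabla>\<^sub>X a)\<close> and \<open>a \<xi> = 0\<close>; the rest is the case \<open>Da_b_b\<close> together with \<open>aba = -4 a\<close>.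
\<close>

lemma Da_eq:
  assumes "X \<in> V" "Y \<in> V"
  shows "Da X Y = - (G (a X) (a Y) \<odot> \<xi>)"
proof -
  have a_Da: "a (Da (b X) (b Y)) = 0" if "X \<in> V" "Y \<in> V" for X Y
    using that by (simp add: Da_b_b V_smult F_metric a_smult)
  have 1: "Da (b X) (b (a Y)) = - 4 *\<^sub>R Da (b X) Y" if "X \<in> V" "Y \<in> V" for X Y
    using Da_a_b_b_a[of "b X" Y] Da_a[of "b X" "b Y"] a_Da that by simp
  have 2: "Da X (b (a Y)) = - 4 *\<^sub>R Da X Y" if "X \<in> V" "Y \<in> V" for X Y
  proof -
    have "4 *\<^sub>R a (Da X (b Y)) = - a (Da (b Y) (b (a X)))"
      using 1[of Y X] Da_sym[of X "b Y"] that by simp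
    then have "a (Da X (b Y)) = 0"
      using a_Da that by simp
    then show ?thesis
      using Da_a_b_b_a[of X Y] Da_a[of X "b Y"] that by simp
  qed
  have "16 *\<^sub>R Da X Y = Da (b (a X)) (b (a Y))"
    using 2[of "b (a X)" Y] 2[of Y X] Da_sym[of Y "b (a X)"] Da_sym[of X Y] assms by simp
  also have "\<dots> = - (G (a (b (a X))) (a (b (a Y))) \<odot> \<xi>)"
    using assms by (intro Da_b_b) auto
  also have "G (a (b (a X))) (a (b (a Y))) = (\<lambda>p. 16 * G (a X) (a Y) p)"
    using assms by (auto simp: fun_eq_iff)
  also have "- ((\<lambda>p. 16 * G (a X) (a Y) p) \<odot> \<xi>) = 16 *\<^sub>R (- (G (a X) (a Y) \<odot> \<xi>))"
    by (simp add: smult_def scaleR_fun_def fun_eq_iff)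
  finally show ?thesis
    by (metis real_vector.scale_cancel_left zero_neq_numeral)
qed

text \<open>
  Flatness applied to \<open>a\<close> itself: the second covariant derivative of \<open>a\<close> is symmetric in its two
  directions. By \<open>Da_eq\<close>, up to multiples of \<open>\<xi>\<close> it is \<open>- G(a Y, a Z) a X\<close>, so that
  \<open>G(a Y, a Z) a X = G(a X, a Z) a Y\<close>; a bilinear form with this property has rank at most one.
\<close>

lemma G_a_a_rank_one:
  assumes "X \<in> V" "Y \<in> V" "Z \<in> V" "W \<in> V"
  shows "G (a Y) (a Z) p * G (a X) (a W) p = G (a X) (a Z) p * G (a Y) (a W) p"
proof -
  have Da_a0: "G (Da X Z) (a W) p = 0" if "X \<in> V" "Z \<in> V" for X Z p
    using that assms by (simp add: Da_eq V_smult F_metric G_smult)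
  have step: "G (D X (D Y (a Z))) (a W) p =
      G (a (D X (D Y Z))) (a W) p - G (a Y) (a Z) p * G (a X) (a W) p"
    if "X \<in> V" "Y \<in> V" for X Y
  proof -
    have "D X (D Y (a Z)) = a (D X (D Y Z)) + Da X (D Y Z) + D X (Da Y Z)"
      using that assms by (simp add: Da_def)
    moreover have "G (D X (Da Y Z)) (a W) p = - G (a Y) (a Z) p * G (a X) (a W) p"
    proof -
      have "G (Da Y Z) (a W) = (\<lambda>_. 0)"
        using Da_a0 that assms by blast
      then have "G (D X (Da Y Z)) (a W) p = - G (Da Y Z) (D X (a W)) p"
        using D_metric[of X "Da Y Z" "a W" p] act_const[of X 0 p] that assms by simp
      also have "\<dots> = G (a Y) (a Z) p * G \<xi> (D X (a W)) p"
        using that assms by (simp add: Da_eq V_smult F_metric G_smult)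
      also have "G \<xi> (D X (a W)) p = G (Da X W) \<xi> p"
        using that assms G_sym[of \<xi> "D X (a W)"] by (simp add: Da_def)
      finally show ?thesis
        using that assms by (simp add: G_Da_\<xi>)
    qed
    ultimately show ?thesis
      using that assms by (simp add: Da_a0)
  qed
  have bracket: "G (D (D X Y - D Y X) (a Z)) (a W) p = G (a (D (D X Y - D Y X) Z)) (a W) p"
    using assms Da_a0[of "D X Y - D Y X" Z p] by (simp add: Da_def)
  have "G (D X (D Y (a Z)) - D Y (D X (a Z)) - D (D X Y - D Y X) (a Z)) (a W) p = 0"
    using flat[of X Y "a Z"] assms by simp
  moreover have "G (a (D X (D Y Z) - D Y (D X Z) - D (D X Y - D Y X) Z)) (a W) p = 0"
    using flat[of X Y Z] assms by simp
  ultimately show ?thesis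
    using step[of X Y] step[of Y X] bracket assms by simp
qed

lemma G_\<Phi>_skew: "X \<in> V \<Longrightarrow> Y \<in> V \<Longrightarrow> G (\<Phi> X) Y p = - G X (\<Phi> Y) p"
  using contact[of X Y p] contact[of Y X p] G_sym[of "\<Phi> X" Y] by simp

text \<open>
  As \<open>s\<close> anticommutes with \<open>\<Phi>\<close>, it exchanges the eigenspaces of \<open>\<Phi>\<close>. These are isotropic because \<open>\<Phi>\<close> is
  skew, so \<open>s\<close> drops out of the pairing between them, and \<open>a\<close> acts like \<open>-\<Phi>\<close>.
\<close>

lemma G_a_a_eigenfields:
  assumes "X \<in> V" "\<Phi> X = X" "W \<in> V" "\<Phi> W = - W"
  shows "G (a X) (a W) p = - 2 * G X W p"
proof -
  have "\<Phi> (s X) = - s X"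
    using s_\<Phi>[OF assms(1)] assms(2) by (metis minus_minus)
  then have sW: "G (s X) W p = 0"
    using G_\<Phi>_skew[of "s X" W p] assms by simp
  then have aW: "G (a X) W p = - G X W p"
    using assms by (simp add: s_def)
  have "G (a X) (a W) p = G (b (a X)) W p"
    using assms by (simp add: G_b_a)
  also have "\<dots> = 2 * G (\<Phi> (a X)) W p"
    using assms by (simp add: b_def)
  also have "\<dots> = 2 * G (a X) W p"
    using assms G_\<Phi>_skew[of "a X" W p] by simp
  finally show ?thesis using aW by simp
qed

text \<open>
  By \<open>G_a_a_rank_one\<close> and \<open>G_a_a_eigenfields\<close> the pairing \<open>G\<close> between the two eigenspaces of \<open>\<Phi>\<close> has rank at
  most one. The +1-eigenspace pairs to zero with itself and with \<open>\<xi>\<close>, so nondegeneracy leaves it no room for two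
  independent vectors.
\<close>

lemma eigenfields_dependent:
  assumes "X \<in> V" "\<Phi> X = X" "Y \<in> V" "\<Phi> Y = Y" "X p \<noteq> 0"
  shows "\<exists>r. Y p = r *\<^sub>R X p"
proof -
  \<comment> \<open>The projection to the -1-eigenspace of \<open>\<Phi>\<close>; it preserves the pairing with the +1-eigenspace.\<close>
  define m where "m Z = (1/2) *\<^sub>R (\<Phi> (\<Phi> Z) - \<Phi> Z)" for Z
  have m [simp]: "m Z \<in> V" "\<Phi> (m Z) = - m Z" if "Z \<in> V" for Z
    using that by (simp_all add: m_def algebra_simps)
  have G_m: "G U (m Z) p = G U Z p" if "U \<in> V" "\<Phi> U = U" "Z \<in> V" for U Z
    using that G_\<Phi>_skew[of U Z p] G_\<Phi>_skew[of U "\<Phi> Z" p] by (simp add: m_def)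
  have proportional: "G X Z p * G Y W p = G Y Z p * G X W p" if "Z \<in> V" "W \<in> V" for Z W
    using G_a_a_rank_one[of Y X "m Z" "m W" p] assms that
    by (simp add: G_a_a_eigenfields G_m)
  obtain Z where Z: "Z \<in> V" "G X Z p \<noteq> 0"
    using G_nondegenerate[of X p] assms by blast
  let ?W = "G X Z p *\<^sub>R Y - G Y Z p *\<^sub>R X"
  have "?W p = 0"
    by (rule G_nondegenerate[of ?W p]) (use assms Z proportional in auto)
  then have "G X Z p *\<^sub>R Y p = G Y Z p *\<^sub>R X p"
    by (simp add: scaleR_fun_def)
  then have "Y p = (G Y Z p / G X Z p) *\<^sub>R X p"
    using Z(2) by (metis (no_types) divide_inverse_commute scaleR_scaleR scaleR_one left_inverse)
  then show ?thesis ..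
qed

end

section \<open>Nonexistence on manifolds\<close>

lemma linear_on_subspaceD:
  assumes "linear_on_subspace S f" "x \<in> S" "y \<in> S"
  shows "f (x + y) = f x + f y" "f (c *\<^sub>R x) = c *\<^sub>R f x"
  using assms by (auto simp: linear_on_subspace_def)

text \<open>
  The Levi-Civita condition enters through vanishing torsion, which turns the Lie brackets in the
  curvature and in \<open>d\<eta>\<close> into covariant derivatives. Putting \<open>Y = \<xi>\<close> into the compatibility of \<open>g\<close> and \<open>\<phi>\<close>
  gives \<open>\<eta>(X) = g(X, \<xi>)\<close>.
\<close>

lemma flat_paracontact_module_vector_fields:
  assumes "smooth_atlas A"
    and paracontact: "paracontact_metric_structure A n \<phi> \<xi> \<eta> g"
    and LC: "levi_civita_connection A g D"
    and flat: "\<forall>X\<in>vector_fields A. \<forall>Y\<in>vector_fields A. \<forall>Z\<in>vector_fields A. curvature D X Y Z = 0"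
  shows "flat_paracontact_module (vector_fields A) (smooth_functions A)
    (\<lambda>X Y p. g p (X p) (Y p)) (\<lambda>X f p. X p f) D (\<lambda>X p. \<phi> p (X p)) \<xi>"
proof -
  interpret smooth_manifold A
    by standard (rule assms(1))
  let ?V = "vector_fields A"
  note tangent = vector_field_in_tangent_space
  have apcm: "almost_paracontact_metric_structure A n \<phi> \<xi> \<eta> g"
    and d\<eta>: "\<And>X Y p. X \<in> ?V \<Longrightarrow> Y \<in> ?V \<Longrightarrow> g p (X p) (\<phi> p (Y p)) = ext_deriv \<eta> X Y p"
    using paracontact by (simp_all add: paracontact_metric_structure_def)
  have apc: "almost_paracontact_structure A n \<phi> \<xi> \<eta>"
    and metric: "pseudo_riemannian_metric A g"
    and compat: "\<And>X Y p. X \<in> ?V \<Longrightarrow> Y \<in> ?V \<Longrightarrow>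
      g p (\<phi> p (X p)) (\<phi> p (Y p)) = - g p (X p) (Y p) + \<eta> p (X p) * \<eta> p (Y p)"
    using apcm by (simp_all add: almost_paracontact_metric_structure_def)
  have tensor: "tensor_field_1_1 A \<phi>" and \<xi>: "\<xi> \<in> ?V"
    and \<phi>_\<xi>: "\<And>p. \<phi> p (\<xi> p) = 0" and \<eta>_\<xi>: "\<And>p. \<eta> p (\<xi> p) = 1"
    and \<eta>_\<phi>: "\<And>p v. v \<in> tangent_space A p \<Longrightarrow> \<eta> p (\<phi> p v) = 0"
    and \<phi>_\<phi>: "\<And>p v. v \<in> tangent_space A p \<Longrightarrow> \<phi> p (\<phi> p v) = v - \<eta> p v *\<^sub>R \<xi> p"
    using apc by (simp_all add: almost_paracontact_structure_def)
  have \<phi>_V: "(\<lambda>p. \<phi> p (X p)) \<in> ?V" if "X \<in> ?V" for X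
    using tensor that by (simp add: tensor_field_1_1_def)
  have \<phi>_linear: "linear_on_subspace (tangent_space A p) (\<phi> p)" for p
    using tensor by (simp add: tensor_field_1_1_def)
  have g_linear: "\<And>p u. u \<in> tangent_space A p \<Longrightarrow> linear_on_subspace (tangent_space A p) (g p u)"
    and g_sym: "\<And>p u v. u \<in> tangent_space A p \<Longrightarrow> v \<in> tangent_space A p \<Longrightarrow> g p u v = g p v u"
    and g_nondeg: "\<And>p u. u \<in> tangent_space A p \<Longrightarrow> \<forall>v\<in>tangent_space A p. g p u v = 0 \<Longrightarrow> u = 0"
    and g_smooth: "\<And>X Y. X \<in> ?V \<Longrightarrow> Y \<in> ?V \<Longrightarrow> (\<lambda>p. g p (X p) (Y p)) \<in> smooth_functions A"
    using metric by (simp_all add: pseudo_riemannian_metric_def)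
  have g_add: "g p (u + v) w = g p u w + g p v w" and g_scale: "g p (c *\<^sub>R u) w = c * g p u w"
    if "u \<in> tangent_space A p" "v \<in> tangent_space A p" "w \<in> tangent_space A p" for p u v w c
    using linear_on_subspaceD[OF g_linear[OF that(3)] that(1,2)] that
      g_sym[OF _ that(3)] subspace_add[OF subspace_tangent_space that(1,2)]
      subspace_scale[OF subspace_tangent_space that(1)] by simp_all
  have g_zero: "g p u 0 = 0" if "u \<in> tangent_space A p" for p u
    using linear_on_subspaceD(2)[OF g_linear[OF that] that that, of 0] by simp
  have \<eta>: "\<eta> p (X p) = g p (X p) (\<xi> p)" if "X \<in> ?V" for X p
    using compat[OF that \<xi>, of p] g_zero[OF tangent[OF \<phi>_V[OF that]], of p]
    by (simp add: \<phi>_\<xi> \<eta>_\<xi>)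
  have affine: "affine_connection A D"
    and torsion: "\<And>X Y. X \<in> ?V \<Longrightarrow> Y \<in> ?V \<Longrightarrow> lie_bracket X Y = D X Y - D Y X"
    and D_metric: "\<And>X Y Z p. X \<in> ?V \<Longrightarrow> Y \<in> ?V \<Longrightarrow> Z \<in> ?V \<Longrightarrow>
      X p (\<lambda>q. g q (Y q) (Z q)) = g p (D X Y p) (Z p) + g p (Y p) (D X Z p)"
    using LC by (simp_all add: levi_civita_connection_def)
  have D_V: "D X Y \<in> ?V" if "X \<in> ?V" "Y \<in> ?V" for X Y
    using affine that by (simp add: affine_connection_def)
  show ?thesis
  proof
    fix X Y Z p f
    assume X: "X \<in> ?V"
    show "(\<lambda>q. X q f) \<in> smooth_functions A" if "f \<in> smooth_functions A"
      using X that by (simp add: vector_fields_def)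
    show "X p = 0" if "\<And>Y. Y \<in> ?V \<Longrightarrow> g p (X p) (Y p) = 0"
      by (rule g_nondeg[OF tangent[OF X]]) (metis that vector_field_through)
    show "g p (\<phi> p (X p)) (\<xi> p) = 0"
      using \<eta>[OF \<phi>_V[OF X], of p] \<eta>_\<phi>[OF tangent[OF X]] by simp
    show "(\<lambda>p. \<phi> p (\<phi> p (X p))) = X - (\<lambda>p. g p (X p) (\<xi> p)) \<odot> \<xi>"
      using \<phi>_\<phi>[OF tangent[OF X]] by (simp add: fun_eq_iff smult_def \<eta>[OF X])
    show "f \<odot> X \<in> ?V" if "f \<in> smooth_functions A"
      using vector_fields_smult[OF that X] by (simp add: smult_def)
    show "(\<lambda>p. \<phi> p ((f \<odot> X) p)) = f \<odot> (\<lambda>p. \<phi> p (X p))"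
      using linear_on_subspaceD(2)[OF \<phi>_linear tangent[OF X] tangent[OF X]]
      by (simp add: fun_eq_iff smult_def)
    assume Y: "Y \<in> ?V"
    show "(\<lambda>p. \<phi> p ((X + Y) p)) = (\<lambda>p. \<phi> p (X p)) + (\<lambda>p. \<phi> p (Y p))"
      using linear_on_subspaceD(1)[OF \<phi>_linear tangent[OF X] tangent[OF Y]]
      by (simp add: fun_eq_iff)
    show "(\<lambda>p. g p (X p) (Y p)) = (\<lambda>p. g p (Y p) (X p))"
      using g_sym[OF tangent[OF X] tangent[OF Y]] by simp
    show "g p ((f \<odot> X) p) (Y p) = f p * g p (X p) (Y p)"
      using g_scale[OF tangent[OF X] tangent[OF X] tangent[OF Y]] by (simp add: smult_def)
    show "D (f \<odot> X) Y = f \<odot> D X Y"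
      and "D X (f \<odot> Y) = (\<lambda>p. X p f) \<odot> Y + f \<odot> D X Y" if "f \<in> smooth_functions A"
      using affine X Y that by (simp_all add: affine_connection_def smult_def plus_fun_def)
    show "g p (D X \<xi> p) (Y p) - g p (D Y \<xi> p) (X p) = 2 * g p (X p) (\<phi> p (Y p))"
    proof -
      have "g p ((D X Y - D Y X) p) (\<xi> p) = g p (D X Y p) (\<xi> p) - g p (D Y X p) (\<xi> p)"
        using g_add[of "D X Y p" p "- D Y X p" "\<xi> p"] g_scale[of "D Y X p" p "D Y X p" "\<xi> p" "- 1"]
          tangent[of _ p] subspace_neg[OF subspace_tangent_space[of p]] D_V X Y \<xi> by simp
      moreover have diff_V: "D X Y - D Y X \<in> ?V"
        using vector_fields_add[OF D_V[OF X Y]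
            vector_fields_smult[OF smooth_functions_const[of "- 1"] D_V[OF Y X]]]
        by (simp add: plus_fun_def fun_diff_def)
      ultimately have "2 * g p (X p) (\<phi> p (Y p)) = X p (\<lambda>q. g q (Y q) (\<xi> q)) -
          Y p (\<lambda>q. g q (X q) (\<xi> q)) - (g p (D X Y p) (\<xi> p) - g p (D Y X p) (\<xi> p))"
        using d\<eta>[OF X Y, of p] \<eta>[OF diff_V, of p] by (simp add: ext_deriv_def \<eta> X Y torsion)
      then show ?thesis
        using D_metric[OF X Y \<xi>, of p] D_metric[OF Y X \<xi>, of p]
          g_sym[OF tangent[OF X] tangent[OF D_V[OF Y \<xi>]]]
          g_sym[OF tangent[OF Y] tangent[OF D_V[OF X \<xi>]]] by simp
    qed
    assume Z: "Z \<in> ?V"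
    show "g p ((X + Y) p) (Z p) = g p (X p) (Z p) + g p (Y p) (Z p)"
      using g_add[OF tangent[OF X] tangent[OF Y] tangent[OF Z]] by simp
    show "X p (\<lambda>p. g p (Y p) (Z p)) = g p (D X Y p) (Z p) + g p (Y p) (D X Z p)"
      by (rule D_metric[OF X Y Z])
    show "D (X + Y) Z = D X Z + D Y Z" and "D X (Y + Z) = D X Y + D X Z"
      using affine X Y Z by (simp_all add: affine_connection_def)
    show "D X (D Y Z) - D Y (D X Z) - D (D X Y - D Y X) Z = 0"
      using flat X Y Z torsion[OF X Y] by (simp add: curvature_def)
  qed (use \<xi> \<phi>_V \<phi>_\<xi> D_V \<eta>[OF \<xi>] \<eta>_\<xi> in \<open>auto intro: vector_fields_add g_smooth
    smooth_functions_const vector_field_const\<close>)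
qed

theorem theorem3p1:
  fixes n :: nat
    and A :: "('a::{t2_space, second_countable_topology}, 'e::euclidean_space) chart set"
  assumes "n \<ge> 2"
    and "smooth_atlas A"
    and "DIM('e) = 2 * n + 1"
  shows "\<not> (\<exists>\<phi> \<xi> \<eta> g D.
            paracontact_metric_structure A n \<phi> \<xi> \<eta> g \<and>
            levi_civita_connection A g D \<and>
            (\<forall>X\<in>vector_fields A. \<forall>Y\<in>vector_fields A. \<forall>Z\<in>vector_fields A.
               curvature D X Y Z = 0))"
proof
  assume "\<exists>\<phi> \<xi> \<eta> g D.
            paracontact_metric_structure A n \<phi> \<xi> \<eta> g \<and>
            levi_civita_connection A g D \<and>
            (\<forall>X\<in>vector_fields A. \<forall>Y\<in>vector_fields A. \<forall>Z\<in>vector_fields A.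
               curvature D X Y Z = 0)"
  then obtain \<phi> \<xi> \<eta> g D where
    paracontact: "paracontact_metric_structure A n \<phi> \<xi> \<eta> g"
    and flat: "levi_civita_connection A g D"
      "\<forall>X\<in>vector_fields A. \<forall>Y\<in>vector_fields A. \<forall>Z\<in>vector_fields A. curvature D X Y Z = 0"
    by blast
  interpret smooth_manifold A
    by standard (rule assms(2))
  interpret flat_paracontact_module "vector_fields A" "smooth_functions A"
    "\<lambda>X Y p. g p (X p) (Y p)" "\<lambda>X f p. X p f" D "\<lambda>X p. \<phi> p (X p)" \<xi>
    by (rule flat_paracontact_module_vector_fields[OF assms(2) paracontact flat])
  \<comment> \<open>One point suffices; the manifold is nonempty because types are.\<close>
  fix p :: 'a
  define E where "E = {v \<in> {v \<in> tangent_space A p. \<eta> p v = 0}. \<phi> p v = v}"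
  have "dim E = n"
    using paracontact unfolding E_def paracontact_metric_structure_def
      almost_paracontact_metric_structure_def almost_paracontact_structure_def Let_def by blast
  have eigenfield: "\<exists>X\<in>vector_fields A. (\<lambda>p. \<phi> p (X p)) = X \<and> X p = v" if "v \<in> E" for v
  proof -
    have "v \<in> tangent_space A p" and \<phi>v: "\<phi> p v = v"
      using that by (auto simp: E_def)
    then obtain Y where Y: "Y \<in> vector_fields A" "Y p = v"
      by (metis vector_field_through)
    let ?\<Phi> = "\<lambda>X p. \<phi> p (X p)"
    \<comment> \<open>The projection to the +1-eigenspace, which fixes \<open>v\<close>.\<close>
    let ?X = "(1/2) *\<^sub>R (?\<Phi> Y + ?\<Phi> (?\<Phi> Y))"
    have "?X \<in> vector_fields A"
      using Y(1) by (intro V_closed)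
    moreover have "?\<Phi> ?X = ?X"
      using Y(1) \<Phi>_linear(3)[of "?\<Phi> Y + ?\<Phi> (?\<Phi> Y)" "1/2"] \<Phi>_linear(2)[of "?\<Phi> Y" "?\<Phi> (?\<Phi> Y)"]
        \<Phi>_\<Phi>_\<Phi>[of Y] V_closed(3)[of Y] V_closed(3)[of "?\<Phi> Y"] V_closed(5)[of "?\<Phi> Y" "?\<Phi> (?\<Phi> Y)"]
      by (simp only: add.commute)
    moreover have "?X p = v"
      using Y(2) \<phi>v by (simp add: scaleR_fun_def scaleR_add_right[symmetric] flip: scaleR_2)
    ultimately show ?thesis by blast
  qed
  obtain u where "E \<subseteq> span {u}"
  proof (cases "E \<subseteq> {0}")
    case True
    then show ?thesis using that[of 0] by (auto simp: span_zero)
  next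
    case False
    then obtain u where u: "u \<in> E" "u \<noteq> 0" by blast
    obtain X where X: "X \<in> vector_fields A" "(\<lambda>p. \<phi> p (X p)) = X" "X p = u"
      using eigenfield[OF u(1)] by blast
    have "v \<in> span {u}" if v: "v \<in> E" for v
    proof -
      obtain Y where Y: "Y \<in> vector_fields A" "(\<lambda>p. \<phi> p (Y p)) = Y" "Y p = v"
        using eigenfield[OF v] by blast
      then obtain r where "v = r *\<^sub>R u"
        using eigenfields_dependent[OF X(1,2) Y(1,2), of p] X(3) u(2) by blast
      then show ?thesis by (simp add: span_breakdown_eq span_base span_scale)
    qed
    then show ?thesis using that by blast
  qed
  then have "dim E \<le> card {u}"
    by (rule real_vector.dim_le_card) simp
  with \<open>dim E = n\<close> \<open>n \<ge> 2\<close> show False by simp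
qed

end
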